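(* Let $Q_1,Q_2\ge1$ and $\varepsilon>0$ be given. Then there are $p\in(1,\infty)$, functions $u_1$, $u_2$ and an interval $I=(x_0,1)$, $0\le x_0<1$, such that (with respect to this $p$) $u_1$ is a $Q_1$-quasiminimizer in $I$, $u_2$ is a $Q_2$-quasiminimizer in $\Omega=(0,1)$, and $$u=\begin{cases} u_2, & \text{in } \Omega\setminus I,\\ \min\{u_1,u_2\}, & \text{in } I,\end{cases}$$ is a $Q$-quasisuperminimizer in $\Omega$ with optimal quasisuperminimizer constant $$Q\ge Q_1Q_2-\varepsilon.$$
   Context: Let $1<p<\infty$, let $\Omega\subset\mathbf{R}^n$ be a nonempty open set and $Q\ge1$. A function $u\in W^{1,p}_{\rm loc}(\Omega)$ is a $Q$-quasiminimizer in $\Omega$ if $$\int_{\varphi\ne0}|\nabla u|^p\,dx\le Q\int_{\varphi\ne0}|\nabla(u+\varphi)|^p\,dx$$ for all $\varphi\in W^{1,p}_0(\Omega)$, where the integrals are over $\{x\in\Omega:\varphi(x)\ne0\}$. It is a $Q$-quasisuperminimizer in $\Omega$ if this inequality holds for all nonnegative $\varphi\in W^{1,p}_0(\Omega)$. The optimal quasisuperminimizer constant of $u$ in $\Omega$ is the smallest $Q\ge1$ for which $u$ is a $Q$-quasisuperminimizer in $\Omega$. Here $n=1$. *)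

theory Defs
  imports "HOL-Analysis.Analysis"
begin

text \<open>
  Sobolev spaces on open subsets of the real line. Functions on \<open>\<Omega>\<close> are represented by total
  functions; apart from test functions, which are smooth on the whole line, they matter only up to
  null sets in \<open>\<Omega>\<close>.
\<close>

definition test_function :: "real set \<Rightarrow> (real \<Rightarrow> real) \<Rightarrow> bool" where
  "test_function \<Omega> \<psi> \<longleftrightarrow>
     (\<forall>k x. (deriv ^^ k) \<psi> differentiable at x) \<and>
     compact (closure {x. \<psi> x \<noteq> 0}) \<and> closure {x. \<psi> x \<noteq> 0} \<subseteq> \<Omega>"

definition in_Lp :: "real \<Rightarrow> real set \<Rightarrow> (real \<Rightarrow> real) \<Rightarrow> bool" where
  "in_Lp p S f \<longleftrightarrow>
     f \<in> borel_measurable (lebesgue_on S) \<and> integrable (lebesgue_on S) (\<lambda>x. \<bar>f x\<bar> powr p)"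

definition in_Lp_loc :: "real \<Rightarrow> real set \<Rightarrow> (real \<Rightarrow> real) \<Rightarrow> bool" where
  "in_Lp_loc p \<Omega> f \<longleftrightarrow> (\<forall>K. compact K \<and> K \<subseteq> \<Omega> \<longrightarrow> in_Lp p K f)"

definition has_weak_deriv :: "real set \<Rightarrow> (real \<Rightarrow> real) \<Rightarrow> (real \<Rightarrow> real) \<Rightarrow> bool" where
  "has_weak_deriv \<Omega> u v \<longleftrightarrow>
     in_Lp_loc 1 \<Omega> u \<and> in_Lp_loc 1 \<Omega> v \<and>
     (\<forall>\<psi>. test_function \<Omega> \<psi> \<longrightarrow>
        (\<integral>x. u x * deriv \<psi> x \<partial>lebesgue_on \<Omega>) = - (\<integral>x. v x * \<psi> x \<partial>lebesgue_on \<Omega>))"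

text \<open>For open \<open>\<Omega>\<close>, a weak derivative is unique up to null sets if it exists, so the choice of representative is
  harmless.\<close>

definition weak_deriv :: "real set \<Rightarrow> (real \<Rightarrow> real) \<Rightarrow> real \<Rightarrow> real" where
  "weak_deriv \<Omega> u = (SOME v. has_weak_deriv \<Omega> u v)"

definition W1p :: "real \<Rightarrow> real set \<Rightarrow> (real \<Rightarrow> real) set" where
  "W1p p \<Omega> = {u. in_Lp p \<Omega> u \<and> (\<exists>v. has_weak_deriv \<Omega> u v \<and> in_Lp p \<Omega> v)}"

definition W1p_loc :: "real \<Rightarrow> real set \<Rightarrow> (real \<Rightarrow> real) set" where
  "W1p_loc p \<Omega> = {u. in_Lp_loc p \<Omega> u \<and> (\<exists>v. has_weak_deriv \<Omega> u v \<and> in_Lp_loc p \<Omega> v)}"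

definition W1p_norm :: "real \<Rightarrow> real set \<Rightarrow> (real \<Rightarrow> real) \<Rightarrow> real" where
  "W1p_norm p \<Omega> u =
     (\<integral>x. \<bar>u x\<bar> powr p + \<bar>weak_deriv \<Omega> u x\<bar> powr p \<partial>lebesgue_on \<Omega>) powr (1 / p)"

text \<open>The closure of the test functions in \<^term>\<open>W1p p \<Omega>\<close>.\<close>

definition W1p_0 :: "real \<Rightarrow> real set \<Rightarrow> (real \<Rightarrow> real) set" where
  "W1p_0 p \<Omega> =
     {u \<in> W1p p \<Omega>. \<forall>e>0. \<exists>\<psi>. test_function \<Omega> \<psi> \<and> W1p_norm p \<Omega> (\<lambda>x. u x - \<psi> x) < e}"

text \<open>
  The energies are extended nonnegative reals: a function that is only locally in the Sobolev
  space may have infinite energy on \<open>{x \<in> \<Omega>. \<phi> x \<noteq> 0}\<close>.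
\<close>

definition energy :: "real \<Rightarrow> real set \<Rightarrow> (real \<Rightarrow> real) \<Rightarrow> (real \<Rightarrow> real) \<Rightarrow> ennreal" where
  "energy p \<Omega> \<phi> u =
     (\<integral>\<^sup>+x\<in>{x \<in> \<Omega>. \<phi> x \<noteq> 0}. ennreal (\<bar>weak_deriv \<Omega> u x\<bar> powr p) \<partial>lebesgue)"

definition quasiminimizer :: "real \<Rightarrow> real \<Rightarrow> real set \<Rightarrow> (real \<Rightarrow> real) \<Rightarrow> bool" where
  "quasiminimizer p Q \<Omega> u \<longleftrightarrow>
     u \<in> W1p_loc p \<Omega> \<and>
     (\<forall>\<phi> \<in> W1p_0 p \<Omega>. energy p \<Omega> \<phi> u \<le> ennreal Q * energy p \<Omega> \<phi> (\<lambda>x. u x + \<phi> x))"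

definition quasisuperminimizer :: "real \<Rightarrow> real \<Rightarrow> real set \<Rightarrow> (real \<Rightarrow> real) \<Rightarrow> bool" where
  "quasisuperminimizer p Q \<Omega> u \<longleftrightarrow>
     u \<in> W1p_loc p \<Omega> \<and>
     (\<forall>\<phi> \<in> W1p_0 p \<Omega>. (AE x in lebesgue_on \<Omega>. 0 \<le> \<phi> x) \<longrightarrow>
        energy p \<Omega> \<phi> u \<le> ennreal Q * energy p \<Omega> \<phi> (\<lambda>x. u x + \<phi> x))"

definition optimal_quasisuperminimizer_constant ::
    "real \<Rightarrow> real set \<Rightarrow> (real \<Rightarrow> real) \<Rightarrow> real \<Rightarrow> bool" where
  "optimal_quasisuperminimizer_constant p \<Omega> u Q \<longleftrightarrow>
     1 \<le> Q \<and> quasisuperminimizer p Q \<Omega> u \<and>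
     (\<forall>Q'\<ge>1. quasisuperminimizer p Q' \<Omega> u \<longrightarrow> Q \<le> Q')"

end

theory Submission
  imports Defs "HOL-Real_Asymp.Real_Asymp"
begin

text \<open>
  On an interval, a function whose derivative lies between two positive constants \<open>d \<le> s\<close> is a
  quasiminimizer with constant \<open>(s / d) powr (p - 1)\<close>
  (\<open>quasiminimizer_if_slopes_between\<close>). Let \<open>G\<close> be the set where the test function \<open>\<phi>\<close> does not
  vanish. The integral of \<open>u' powr p\<close> over \<open>G\<close> is at most \<open>s powr (p - 1)\<close> times that of \<open>u'\<close>. The
  tangent of \<open>y \<mapsto> \<bar>y\<bar> powr p\<close> at \<open>d\<close> bounds the integral of \<open>\<bar>u' + \<phi>'\<bar> powr p\<close> over \<open>G\<close> from below
  by \<open>d powr (p - 1)\<close> times that of \<open>u'\<close>, because \<open>\<phi>'\<close> has integral \<open>0\<close> over \<open>G\<close>.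

  For \<open>p\<close> close to \<open>1\<close> this bound is almost attained by a function with only two slopes. Let the
  slope be \<open>q\<close> times larger in a final piece of relative length \<open>r = K / (K + q)\<close>, where
  \<open>q powr (p - 1) = Q\<close>. The steep piece alone then has at least \<open>\<kappa> * Q\<close> times the energy of the
  affine function with the same boundary values, where \<open>\<kappa> = K / (1 + K) powr p\<close>
  (\<open>energy_of_steep_part\<close>). With \<open>K = 1 / (p - 1)\<close>, this \<open>\<kappa>\<close> tends to \<open>1\<close> as \<open>p\<close> decreases to \<open>1\<close>
  (\<open>exists_exponent_near_1\<close>).

  So almost all the energy sits on the steep piece, and the construction can be nested. Take for \<open>u2\<close>
  the two-slope function on \<open>(0, 1)\<close> with ratio \<open>q2\<close>, and let \<open>I = (x0, 1)\<close> be its steep piece, where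
  it is affine. Replace \<open>u2\<close> on \<open>I\<close> by a two-slope function with ratio \<open>q1\<close> and the same boundary
  values. The result \<open>u1\<close> lies below \<open>u2\<close>, so the function in question is \<open>u1\<close> itself. It lies below
  the affine function with the same boundary values, which is therefore an admissible competitor, and
  its last piece already has at least \<open>\<kappa>\<^sup>2 * Q1 * Q2\<close> times the energy of that competitor. An optimal
  constant exists because all slopes of \<open>u1\<close> lie between two positive constants, and the admissible
  constants form a closed set.

  Three facts on Sobolev functions of one variable carry this over to the weak formulation. Weak
  derivatives are unique (\<open>weak_deriv_unique\<close>). The integral of \<open>\<phi>'\<close> over the set
  where \<open>\<phi>\<close> does not vanish is \<open>0\<close> for \<open>\<phi>\<close> in \<open>W1p_0\<close> (\<open>W1p_0_weak_derivE\<close>). Piecewise affine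
  functions that vanish at the end points belong to \<open>W1p_0\<close> (a consequence of
  \<open>W1p_0_if_piecewise_derivative_limit\<close>).
\<close>

section \<open>Smooth functions and bumps\<close>

definition smooth :: "(real \<Rightarrow> real) \<Rightarrow> bool" where
  "smooth f \<longleftrightarrow> (\<forall>k x. (deriv ^^ k) f differentiable at x)"

text \<open>
  Exhibiting a class of functions that is closed under differentiation spares explicit formulas for
  the higher derivatives.
\<close>

lemma smooth_coinduct:
  assumes "f \<in> S"
    and step: "\<And>g. g \<in> S \<Longrightarrow> \<exists>g'\<in>S. \<forall>x. (g has_real_derivative g' x) (at x)"
  shows "smooth f"
proof -
  have dS: "deriv g \<in> S" if g: "g \<in> S" for g
  proof -
    obtain g' where "g' \<in> S" "\<forall>x. (g has_real_derivative g' x) (at x)"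
      using step[OF g] by auto
    moreover from this have "deriv g = g'" by (auto intro!: DERIV_imp_deriv)
    ultimately show ?thesis by simp
  qed
  have "(deriv ^^ k) f \<in> S" for k
    by (induction k) (auto simp: assms dS)
  then show ?thesis
    unfolding smooth_def using step by (metis real_differentiable_def)
qed

lemma smooth_deriv: "smooth f \<Longrightarrow> smooth (deriv f)"
  unfolding smooth_def by (metis comp_apply funpow_Suc_right)

lemma smooth_DERIV: "smooth f \<Longrightarrow> (f has_real_derivative deriv f x) (at x)"
  unfolding smooth_def
  by (metis DERIV_deriv_iff_real_differentiable eq_id_iff funpow_0)

lemma smooth_antideriv:
  assumes g: "smooth g" and F: "\<And>x. (F has_real_derivative g x) (at x)"
  shows "smooth F"
proof (rule smooth_coinduct)
  show "F \<in> insert F {h. smooth h}" by simp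
qed (use g F smooth_deriv smooth_DERIV in \<open>blast\<close>)

lemma smooth_continuous: "smooth f \<Longrightarrow> continuous_on A f"
  by (meson DERIV_continuous_on smooth_DERIV has_field_derivative_at_within)

lemma smooth_measurable:
  assumes "smooth f" shows "f \<in> borel_measurable lebesgue"
proof -
  have "f \<in> borel_measurable lborel"
    using borel_measurable_continuous_onI[OF smooth_continuous[OF assms]] by simp
  then show ?thesis by (rule measurable_completion)
qed

lemma smooth_const: "smooth (\<lambda>x. c)"
  by (rule smooth_coinduct[where S="range (\<lambda>c x. c)"])
    (auto intro!: exI[of _ 0] derivative_eq_intros)

lemma smooth_add:
  assumes "smooth f" "smooth g" shows "smooth (\<lambda>x. f x + g x)"
proof (rule smooth_coinduct)
  show "(\<lambda>x. f x + g x) \<in> {\<lambda>x. f x + g x |f g. smooth f \<and> smooth g}" using assms by auto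
next
  fix h assume "h \<in> {\<lambda>x. f x + g x |f g. smooth f \<and> smooth g}"
  then obtain f g where h: "h = (\<lambda>x. f x + g x)" "smooth f" "smooth g" by auto
  then show "\<exists>g'\<in>{\<lambda>x. f x + g x |f g. smooth f \<and> smooth g}. \<forall>x. (h has_real_derivative g' x) (at x)"
    by (intro bexI[of _ "\<lambda>x. deriv f x + deriv g x"])
      (auto intro!: derivative_eq_intros smooth_DERIV smooth_deriv)
qed

text \<open>
  The sums of products of two smooth functions: by the Leibniz rule they contain their derivatives,
  which the products alone do not.
\<close>

inductive_set product_sums :: "(real \<Rightarrow> real) set" where
  prod: "smooth f \<Longrightarrow> smooth g \<Longrightarrow> (\<lambda>x. f x * g x) \<in> product_sums"
| sum: "a \<in> product_sums \<Longrightarrow> b \<in> product_sums \<Longrightarrow> (\<lambda>x. a x + b x) \<in> product_sums"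

lemma smooth_mult:
  assumes "smooth f" "smooth g" shows "smooth (\<lambda>x. f x * g x)"
proof (rule smooth_coinduct)
  show "(\<lambda>x. f x * g x) \<in> product_sums" using assms by (rule product_sums.prod)
next
  fix h assume "h \<in> product_sums"
  then show "\<exists>h'\<in>product_sums. \<forall>x. (h has_real_derivative h' x) (at x)"
  proof induction
    case (prod f g)
    have "(\<lambda>x. f x * deriv g x + deriv f x * g x) \<in> product_sums"
      by (intro product_sums.intros smooth_deriv prod)
    moreover have "((\<lambda>x. f x * g x) has_real_derivative f x * deriv g x + deriv f x * g x) (at x)" for x
      by (auto intro!: derivative_eq_intros smooth_DERIV prod)
    ultimately show ?case by (auto intro: bexI[rotated])
  next
    case (sum a b)
    then obtain a' b' where "a' \<in> product_sums" "b' \<in> product_sums"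
      "\<And>x. (a has_real_derivative a' x) (at x)" "\<And>x. (b has_real_derivative b' x) (at x)" by blast
    then show ?case
      by (intro bexI[of _ "\<lambda>x. a' x + b' x"]) (auto intro!: derivative_eq_intros product_sums.sum)
  qed
qed

lemma smooth_affine:
  assumes "smooth f" shows "smooth (\<lambda>x. f (a * x + b))"
proof (rule smooth_coinduct)
  let ?S = "{\<lambda>x. c * f (a * x + b) |c f. smooth f}"
  show "(\<lambda>x. f (a * x + b)) \<in> ?S"
    using assms by (auto intro!: exI[of _ "1::real"] exI[of _ f])
  fix h assume "h \<in> ?S"
  then obtain c f where h: "h = (\<lambda>x. c * f (a * x + b))" "smooth f" by auto
  have "((\<lambda>x. f (a * x + b)) has_real_derivative deriv f (a * x + b) * a) (at x)" for x
    by (rule DERIV_chain2[where f=f, OF smooth_DERIV[OF h(2)]]) (auto intro!: derivative_eq_intros)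
  then have "\<forall>x. (h has_real_derivative (c * a) * deriv f (a * x + b)) (at x)"
    unfolding h(1) by (auto intro!: derivative_eq_intros)
  moreover have "(\<lambda>x. (c * a) * deriv f (a * x + b)) \<in> ?S"
    using smooth_deriv[OF h(2)] by blast
  ultimately show "\<exists>g'\<in>?S. \<forall>x. (h has_real_derivative g' x) (at x)" by (rule bexI)
qed

text \<open>
  For \<open>q = 1\<close> this is the usual smooth function that vanishes to infinite order at \<open>0\<close>. The factor
  \<open>q\<close> makes the class closed under differentiation.
\<close>

definition flat :: "real poly \<Rightarrow> real \<Rightarrow> real" where
  "flat q x = (if x \<le> 0 then 0 else poly q (1/x) * exp (-1/x))"

lemma poly_times_exp_tendsto_0: "((\<lambda>y. poly q y * exp (- y)) \<longlongrightarrow> (0::real)) at_top"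
proof -
  have "((\<lambda>y. \<Sum>i\<le>degree q. coeff q i * (y ^ i / exp y)) \<longlongrightarrow> (\<Sum>i\<le>degree q. coeff q i * (0::real))) at_top"
    by (intro tendsto_intros tendsto_power_div_exp_0)
  then show ?thesis
    by (simp add: poly_altdef sum_distrib_right sum_divide_distrib exp_minus field_simps)
qed

lemma flat_tendsto_0: "((\<lambda>x::real. poly q (1/x) * exp (-1/x)) \<longlongrightarrow> 0) (at_right 0)"
proof -
  have "((\<lambda>x::real. poly q (inverse x) * exp (- inverse x)) \<longlongrightarrow> 0) (at_right 0)"
    by (rule filterlim_compose[OF poly_times_exp_tendsto_0 filterlim_inverse_at_top_right])
  then show ?thesis by (simp add: divide_inverse)
qed

text \<open>
  Away from \<open>0\<close> this is the product rule in the variable \<open>1 / x\<close>. At \<open>0\<close> the difference quotient from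
  the right is again a polynomial in \<open>1 / x\<close> times \<open>exp (-1/x)\<close>, hence tends to \<open>0\<close>.
\<close>

lemma flat_has_derivative:
  "(flat q has_real_derivative flat ([:0, 0, 1:] * (q - pderiv q)) x) (at x)"
proof -
  let ?q' = "[:0, 0, 1:] * (q - pderiv q)"
  consider "x < 0" | "x = 0" | "x > 0" by linarith
  then show ?thesis
  proof cases
    case 1
    have "((\<lambda>x. 0) has_real_derivative flat ?q' x) (at x)" using 1 by (simp add: flat_def)
    then show ?thesis
      by (rule DERIV_cong_ev[OF refl _ refl, THEN iffD1, rotated])
        (use 1 in \<open>auto simp: flat_def eventually_nhds intro!: exI[of _ "{..<0}"]\<close>)
  next
    case 2
    have l: "((\<lambda>h. (flat q (0 + h) - flat q 0) / h) \<longlongrightarrow> 0) (at_left 0)"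
      by (rule tendsto_eventually) (auto simp: flat_def eventually_at_left_field intro!: exI[of _ "-1"])
    have "((\<lambda>x. poly ([:0, 1:] * q) (1/x) * exp (-1/x)) \<longlongrightarrow> 0) (at_right 0)"
      by (rule flat_tendsto_0)
    then have r: "((\<lambda>h. (flat q (0 + h) - flat q 0) / h) \<longlongrightarrow> 0) (at_right 0)"
      by (rule Lim_transform_eventually)
        (auto simp: flat_def eventually_at_right_field intro!: exI[of _ 1])
    show ?thesis unfolding DERIV_def 2
      using l r by (simp add: filterlim_at_split) (simp add: flat_def)
  next
    case 3
    have "((\<lambda>x. poly q (1/x) * exp (-1/x)) has_real_derivative flat ?q' x) (at x)"
      using 3 by (auto simp: flat_def field_simps power2_eq_square intro!: derivative_eq_intros)
    then show ?thesis
      by (rule DERIV_cong_ev[OF refl _ refl, THEN iffD1, rotated])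
        (use 3 in \<open>auto simp: flat_def eventually_nhds intro!: exI[of _ "{0<..}"]\<close>)
  qed
qed

lemma smooth_flat: "smooth (flat q)"
  by (rule smooth_coinduct[where S="range flat"]) (use flat_has_derivative in blast)+

text \<open>
  The shift by \<open>1\<close> keeps the support at distance \<open>1 / n\<close> from the end points, so that the same
  functions are test functions on \<open>(a, b)\<close> and converge pointwise to the indicator function of that interval.
\<close>

definition bump :: "real \<Rightarrow> real \<Rightarrow> nat \<Rightarrow> real \<Rightarrow> real" where
  "bump a b n x = flat 1 (real n * (x - a) - 1) * flat 1 (real n * (b - x) - 1)"

lemma smooth_bump: "smooth (bump a b n)"
proof -
  have "smooth (\<lambda>x. flat 1 (real n * x + (- real n * a - 1)) * flat 1 ((- real n) * x + (real n * b - 1)))"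
    by (intro smooth_mult smooth_affine smooth_flat)
  moreover have "bump a b n = (\<lambda>x. flat 1 (real n * x + (- real n * a - 1)) * flat 1 ((- real n) * x + (real n * b - 1)))"
    by (auto simp: bump_def algebra_simps)
  ultimately show ?thesis by simp
qed

lemma flat_1_bounds: "0 \<le> flat 1 x" "flat 1 x \<le> 1"
  by (auto simp: flat_def)

lemma bump_bounds: "0 \<le> bump a b n x" "bump a b n x \<le> 1"
  by (auto simp: bump_def flat_1_bounds mult_le_one)

lemma bump_abs_le: "\<bar>bump a b n x\<bar> \<le> 1"
  using bump_bounds[of a b n x] by auto

lemma bump_support: "n > 0 \<Longrightarrow> bump a b n x \<noteq> 0 \<Longrightarrow> a + 1 / n \<le> x \<and> x \<le> b - 1 / n"
  by (auto simp: bump_def flat_def field_simps split: if_splits)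

lemma bump_nonzero_imp_between: "bump a b n x \<noteq> 0 \<Longrightarrow> a < x \<and> x < b"
proof -
  assume *: "bump a b n x \<noteq> 0"
  then have "n > 0" by (cases "n = 0") (auto simp: bump_def flat_def)
  moreover have "0 < 1 / real n" using \<open>n > 0\<close> by simp
  ultimately show ?thesis using bump_support[OF _ *] by linarith
qed

lemma flat_1_tendsto:
  assumes "c > 0" shows "(\<lambda>n. flat 1 (real n * c - 1)) \<longlonglongrightarrow> 1"
proof -
  have "(\<lambda>n. exp (- 1 / (real n * c - 1))) \<longlonglongrightarrow> 1" using assms by real_asymp
  moreover have "eventually (\<lambda>n. real n * c - 1 > 0) sequentially" using assms by real_asymp
  ultimately show ?thesis
    by (rule Lim_transform_eventually[OF _ eventually_mono]) (auto simp: flat_def)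
qed

lemma bump_tendsto: "(\<lambda>n. bump a b n x) \<longlonglongrightarrow> indicator {a<..<b} x"
proof (cases "a < x \<and> x < b")
  case True
  then have "(\<lambda>n. bump a b n x) \<longlonglongrightarrow> 1 * 1"
    unfolding bump_def by (intro tendsto_mult flat_1_tendsto) auto
  then show ?thesis using True by simp
next
  case False
  then have "bump a b n x = 0" for n using bump_nonzero_imp_between[of a b n x] by blast
  then show ?thesis using False by (auto simp: indicator_def)
qed

lemma test_function_iff_smooth:
  "test_function \<Omega> \<psi> \<longleftrightarrow>
     smooth \<psi> \<and> compact (closure {x. \<psi> x \<noteq> 0}) \<and> closure {x. \<psi> x \<noteq> 0} \<subseteq> \<Omega>"
  by (simp add: test_function_def smooth_def)

text \<open>
  The zero function is listed separately because an empty interval has no other test functions.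
\<close>

lemma test_function_Ioo_iff:
  "test_function {\<alpha><..<\<beta>} \<psi> \<longleftrightarrow>
     smooth \<psi> \<and> (\<exists>a b. \<alpha> < a \<and> a \<le> b \<and> b < \<beta> \<and> (\<forall>x. \<psi> x \<noteq> 0 \<longrightarrow> a \<le> x \<and> x \<le> b)) \<or>
     \<psi> = (\<lambda>x. 0)"
proof -
  let ?C = "closure {x. \<psi> x \<noteq> 0}"
  have 1: "\<exists>a b. \<alpha> < a \<and> a \<le> b \<and> b < \<beta> \<and> (\<forall>x. \<psi> x \<noteq> 0 \<longrightarrow> a \<le> x \<and> x \<le> b)"
    if C: "compact ?C" "?C \<subseteq> {\<alpha><..<\<beta>}" and "\<psi> \<noteq> (\<lambda>x. 0)"
  proof -
    have ne: "?C \<noteq> {}" using \<open>\<psi> \<noteq> (\<lambda>x. 0)\<close> by auto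
    obtain a where a: "a \<in> ?C" "\<forall>x\<in>?C. a \<le> x" using compact_attains_inf[OF C(1) ne] by auto
    obtain b where b: "b \<in> ?C" "\<forall>x\<in>?C. x \<le> b" using compact_attains_sup[OF C(1) ne] by auto
    show ?thesis
      using a b C(2) closure_subset[of "{x. \<psi> x \<noteq> 0}"]
      by (intro exI[of _ a] exI[of _ b]) (auto simp: subset_iff)
  qed
  have 2: "compact ?C \<and> ?C \<subseteq> {\<alpha><..<\<beta>}"
    if "\<alpha> < a" "b < \<beta>" "\<forall>x. \<psi> x \<noteq> 0 \<longrightarrow> a \<le> x \<and> x \<le> b" for a b
  proof -
    have "?C \<subseteq> {a..b}" using that(3) by (intro closure_minimal) auto
    moreover have "{a..b} \<subseteq> {\<alpha><..<\<beta>}" using that by auto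
    ultimately show ?thesis
      by (metis bounded_closed_interval bounded_subset closed_closure compact_eq_bounded_closed subset_trans)
  qed
  show ?thesis unfolding test_function_iff_smooth using 1 2 smooth_const[of 0] by auto
qed

section \<open>Test functions and integrals over intervals\<close>

lemma lebesgue_on_subset_if_zero:
  fixes g :: "real \<Rightarrow> real"
  assumes "K \<in> sets lebesgue" "S \<in> sets lebesgue" "K \<subseteq> S" "\<And>x. x \<in> S - K \<Longrightarrow> g x = 0"
  shows "integrable (lebesgue_on S) g \<longleftrightarrow> integrable (lebesgue_on K) g" (is ?A)
    and "integral\<^sup>L (lebesgue_on S) g = integral\<^sup>L (lebesgue_on K) g" (is ?B)
proof -
  have "(\<lambda>x. indicat_real S x *\<^sub>R g x) = (\<lambda>x. indicat_real K x *\<^sub>R g x)"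
    using assms(3,4) by (auto simp: fun_eq_iff indicator_def)
  then show ?A ?B
    using assms(1,2) by (auto simp: integrable_restrict_space integral_restrict_space)
qed

lemma in_Lp_1_iff: "in_Lp 1 S f \<longleftrightarrow> integrable (lebesgue_on S) f"
proof
  assume "in_Lp 1 S f"
  then have "f \<in> borel_measurable (lebesgue_on S)" "integrable (lebesgue_on S) (\<lambda>x. \<bar>f x\<bar>)"
    by (auto simp: in_Lp_def)
  then show "integrable (lebesgue_on S) f" by (simp add: integrable_abs_iff)
qed (auto simp: in_Lp_def)

lemma integrable_lebesgue_on_subset:
  fixes f :: "real \<Rightarrow> real"
  assumes "integrable (lebesgue_on S) f" "K \<subseteq> S" "K \<in> sets lebesgue" "S \<in> sets lebesgue"
  shows "integrable (lebesgue_on K) f"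
proof -
  have "set_integrable lebesgue S f"
    unfolding set_integrable_def
    by (rule integrable_restrict_space[THEN iffD1]) (use assms in auto)
  then have "set_integrable lebesgue K f" by (rule set_integrable_subset) fact+
  then show ?thesis
    unfolding set_integrable_def
    by (rule integrable_restrict_space[THEN iffD2, rotated]) (use assms in auto)
qed

lemma finite_measure_lebesgue_on_Ioo: "finite_measure (lebesgue_on {\<alpha><..<\<beta>::real})"
  by (rule finite_measure_lebesgue_on) simp

lemma test_function_0: "test_function {\<alpha><..<\<beta>} (\<lambda>x. 0)"
  by (simp add: test_function_Ioo_iff)

lemma test_function_smooth: "test_function \<Omega> \<psi> \<Longrightarrow> smooth \<psi>"
  by (simp add: test_function_iff_smooth)

lemma test_function_supportE:
  assumes "test_function {\<alpha><..<\<beta>} \<psi>" "\<alpha> < \<beta>"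
  obtains a b where "\<alpha> < a" "a \<le> b" "b < \<beta>" "\<And>x. \<psi> x \<noteq> 0 \<Longrightarrow> a \<le> x \<and> x \<le> b"
    "\<And>x. x < a \<or> b < x \<Longrightarrow> \<psi> x = 0"
proof (cases "\<psi> = (\<lambda>x. 0)")
  case True
  then show ?thesis using that[of "(\<alpha>+\<beta>)/2" "(\<alpha>+\<beta>)/2"] assms(2) by (auto simp: field_simps)
next
  case False
  then obtain a b where "\<alpha> < a" "a \<le> b" "b < \<beta>" "\<forall>x. \<psi> x \<noteq> 0 \<longrightarrow> a \<le> x \<and> x \<le> b"
    using assms(1) by (auto simp: test_function_Ioo_iff)
  then show ?thesis by (intro that[of a b]) force+
qed

lemma deriv_support:
  fixes f :: "real \<Rightarrow> real"
  assumes "\<And>x. f x \<noteq> 0 \<Longrightarrow> a \<le> x \<and> x \<le> b" "deriv f x \<noteq> 0"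
  shows "a \<le> x \<and> x \<le> b"
proof (rule ccontr)
  assume *: "\<not> (a \<le> x \<and> x \<le> b)"
  have "x \<in> - {a..b}" "open (- {a..b})" using * by auto
  then have "eventually (\<lambda>y. y \<in> - {a..b}) (nhds x)" by (rule eventually_nhds_in_open[rotated])
  then have "eventually (\<lambda>y. f y = 0) (nhds x)" by eventually_elim (use assms(1) in auto)
  then have "deriv f x = deriv (\<lambda>y. 0) x" by (rule deriv_cong_ev) simp
  then show False using assms(2) by simp
qed

lemma test_function_deriv:
  assumes "test_function {\<alpha><..<\<beta>} \<psi>"
  shows "test_function {\<alpha><..<\<beta>} (deriv \<psi>)"
proof (cases "\<psi> = (\<lambda>x. 0)")
  case False
  then obtain a b where ab: "\<alpha> < a" "a \<le> b" "b < \<beta>" "\<And>x. \<psi> x \<noteq> 0 \<Longrightarrow> a \<le> x \<and> x \<le> b"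
    using assms by (auto simp: test_function_Ioo_iff)
  then have "\<forall>x. deriv \<psi> x \<noteq> 0 \<longrightarrow> a \<le> x \<and> x \<le> b"
    using deriv_support[of \<psi> a b] by blast
  then show ?thesis
    using ab smooth_deriv[OF test_function_smooth[OF assms]] by (auto simp: test_function_Ioo_iff)
qed (simp add: test_function_0)

lemma test_function_bounded:
  assumes "test_function {\<alpha><..<\<beta>} \<psi>"
  obtains B where "\<And>x. \<bar>\<psi> x\<bar> \<le> B" "0 \<le> B"
proof (cases "\<psi> = (\<lambda>x. 0)")
  case True then show ?thesis using that[of 0] by auto
next
  case False
  then obtain a b where ab: "\<alpha> < a" "a \<le> b" "b < \<beta>" "\<And>x. \<psi> x \<noteq> 0 \<Longrightarrow> a \<le> x \<and> x \<le> b"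
    using assms by (auto simp: test_function_Ioo_iff)
  have "compact (\<psi> ` {a..b})"
    by (intro compact_continuous_image smooth_continuous test_function_smooth[OF assms]) auto
  then obtain B where B: "\<forall>y\<in>\<psi> ` {a..b}. norm y \<le> B" "B > 0"
    using compact_imp_bounded bounded_pos by metis
  have "\<bar>\<psi> x\<bar> \<le> B" for x using B ab(4)[of x] by (cases "\<psi> x = 0") auto
  then show ?thesis using that B(2) by force
qed

lemma test_function_empty: "\<not> \<alpha> < \<beta> \<Longrightarrow> test_function {\<alpha><..<\<beta>} f \<longleftrightarrow> f = (\<lambda>x. 0)"
  unfolding test_function_Ioo_iff by auto

lemma test_function_add:
  assumes "test_function {\<alpha><..<\<beta>} f" "test_function {\<alpha><..<\<beta>} g"
  shows "test_function {\<alpha><..<\<beta>} (\<lambda>x. f x + g x)"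
proof (cases "\<alpha> < \<beta>")
  case True
  obtain a b where ab: "\<alpha> < a" "a \<le> b" "b < \<beta>" "\<And>x. x < a \<or> b < x \<Longrightarrow> f x = 0"
    using test_function_supportE[OF assms(1) True] by metis
  obtain c d where cd: "\<alpha> < c" "c \<le> d" "d < \<beta>" "\<And>x. x < c \<or> d < x \<Longrightarrow> g x = 0"
    using test_function_supportE[OF assms(2) True] by metis
  have "min a c \<le> x \<and> x \<le> max b d" if "f x + g x \<noteq> 0" for x
    using ab(4)[of x] cd(4)[of x] that
    by (cases "a \<le> x \<and> x \<le> b"; cases "c \<le> x \<and> x \<le> d") (auto simp: min_le_iff_disj le_max_iff_disj)
  moreover have "\<alpha> < min a c" "min a c \<le> max b d" "max b d < \<beta>" using ab cd by auto
  ultimately show ?thesis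
    using smooth_add[OF assms[THEN test_function_smooth]] unfolding test_function_Ioo_iff
    by (intro disjI1 conjI exI[of _ "min a c"] exI[of _ "max b d"]) auto
next
  case False
  then have "f = (\<lambda>x. 0)" "g = (\<lambda>x. 0)" using assms test_function_empty[OF False] by blast+
  then show ?thesis by (simp add: test_function_0)
qed

lemma test_function_mult_left:
  assumes "test_function {\<alpha><..<\<beta>} f" "smooth g"
  shows "test_function {\<alpha><..<\<beta>} (\<lambda>x. g x * f x)"
proof (cases "f = (\<lambda>x. 0)")
  case False
  then obtain a b where "\<alpha> < a" "a \<le> b" "b < \<beta>" "\<And>x. f x \<noteq> 0 \<Longrightarrow> a \<le> x \<and> x \<le> b"
    using assms(1) by (auto simp: test_function_Ioo_iff)
  moreover from this have "g x * f x \<noteq> 0 \<longrightarrow> a \<le> x \<and> x \<le> b" for x by simp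
  ultimately show ?thesis
    using smooth_mult[OF assms(2) test_function_smooth[OF assms(1)]]
    unfolding test_function_Ioo_iff by (intro disjI1 conjI exI[of _ a] exI[of _ b]) auto
qed (simp add: test_function_0)

lemma test_function_bump:
  assumes "\<alpha> \<le> a" "b \<le> \<beta>" "n > 0"
  shows "test_function {\<alpha><..<\<beta>} (bump a b n)"
proof (cases "\<exists>x. bump a b n x \<noteq> 0")
  case True
  then have "a + 1 / n \<le> b - 1 / n" using bump_support[OF assms(3)] by fastforce
  moreover have "0 < 1 / real n" using assms by simp
  then have "\<alpha> < a + 1 / n" "b - 1 / n < \<beta>" using assms by linarith+
  ultimately show ?thesis
    unfolding test_function_Ioo_iff using smooth_bump bump_support[OF assms(3)]
    by (intro disjI1 conjI exI[of _ "a + 1 / n"] exI[of _ "b - 1 / n"]) auto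
next
  case False
  then have "bump a b n = (\<lambda>x. 0)" by auto
  then show ?thesis by (simp add: test_function_0)
qed

lemma in_Lp_loc_1D:
  assumes "in_Lp_loc 1 {\<alpha><..<\<beta>} f" "\<alpha> < a" "b < \<beta>"
  shows "integrable (lebesgue_on {a..b}) f"
proof -
  have "{a..b} \<subseteq> {\<alpha><..<\<beta>}" using assms by auto
  then show ?thesis using assms(1) by (auto simp: in_Lp_loc_def in_Lp_1_iff)
qed

lemma integrable_mult_test_function:
  assumes f: "in_Lp_loc 1 {\<alpha><..<\<beta>} f" and \<psi>: "test_function {\<alpha><..<\<beta>} \<psi>"
  shows "integrable (lebesgue_on {\<alpha><..<\<beta>}) (\<lambda>x. f x * \<psi> x)"
proof (cases "\<alpha> < \<beta>")
  case True
  obtain a b where ab: "\<alpha> < a" "a \<le> b" "b < \<beta>" "\<And>x. x < a \<or> b < x \<Longrightarrow> \<psi> x = 0"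
    using test_function_supportE[OF \<psi> True] by metis
  obtain B where B: "\<And>x. \<bar>\<psi> x\<bar> \<le> B" "0 \<le> B" using test_function_bounded[OF \<psi>] by metis
  have f': "integrable (lebesgue_on {a..b}) f" using in_Lp_loc_1D[OF f ab(1,3)] .
  have m: "\<psi> \<in> borel_measurable (lebesgue_on {a..b})"
    by (intro continuous_imp_measurable_on_sets_lebesgue smooth_continuous test_function_smooth[OF \<psi>]) auto
  have "integrable (lebesgue_on {a..b}) (\<lambda>x. f x * \<psi> x)"
  proof (rule Bochner_Integration.integrable_bound)
    show "integrable (lebesgue_on {a..b}) (\<lambda>x. B * f x)" using f' by simp
    show "AE x in lebesgue_on {a..b}. norm (f x * \<psi> x) \<le> norm (B * f x)"
      using B by (auto simp: abs_mult mult.commute intro!: mult_right_mono)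
  qed (use f' m in measurable)
  then show ?thesis
    by (subst lebesgue_on_subset_if_zero(1)[of "{a..b}"]) (use ab in auto)
next
  case False
  then have "{\<alpha><..<\<beta>} = {}" by auto
  then show ?thesis by (simp add: integrable_restrict_space)
qed

lemma borel_sigma_sets_Ioo: "sets borel = sigma_sets UNIV (range (\<lambda>(a,b). {a<..<b::real}))"
proof -
  have "(\<lambda>(a,b). box a b) = (\<lambda>(a,b). {a<..<b::real})" by (auto simp: fun_eq_iff)
  then show ?thesis by (simp add: borel_eq_box)
qed

text \<open>
  The sets over which the integral vanishes form a Dynkin system containing the open intervals, hence
  all Borel sets. Completion adds only null sets, so they also contain the sets where \<open>f\<close> is positive
  or negative.
\<close>

lemma AE_lebesgue_eq_0_if_interval_integrals_eq_0:
  fixes f :: "real \<Rightarrow> real"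
  assumes f: "integrable lebesgue f"
    and zero: "\<And>a b. a < b \<Longrightarrow> set_lebesgue_integral lebesgue {a<..<b} f = 0"
  shows "AE x in lebesgue. f x = 0"
proof -
  have si: "set_integrable lebesgue A f" if "A \<in> sets lebesgue" for A
    unfolding set_integrable_def using f that by (intro integrable_mult_indicator)
  let ?G = "range (\<lambda>(a,b). {a<..<b::real})"
  have univ: "set_lebesgue_integral lebesgue UNIV f = 0"
  proof -
    have "(\<lambda>n. set_lebesgue_integral lebesgue {- real n - 1<..<real n + 1} f) \<longlonglongrightarrow>
        set_lebesgue_integral lebesgue (\<Union>n. {- real n - 1<..<real n + 1}) f"
      by (intro set_integral_cont_up si) (auto simp: incseq_def)
    moreover have "(\<Union>n. {- real n - 1<..<real n + 1}) = UNIV"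
    proof (intro set_eqI iffI UNIV_I)
      fix x :: real
      obtain n where "real n > \<bar>x\<bar>" using reals_Archimedean2 by blast
      then show "x \<in> (\<Union>n. {- real n - 1<..<real n + 1})" by (intro UN_I[of n]) auto
    qed
    ultimately show ?thesis using zero by (simp add: LIMSEQ_const_iff)
  qed
  have borel: "set_lebesgue_integral lebesgue A f = 0" if A: "A \<in> sigma_sets UNIV ?G" for A
  proof (rule sigma_sets_induct_disjoint[OF _ _ A])
    show "Int_stable ?G"
    proof (rule Int_stableI)
      fix A B assume "A \<in> ?G" "B \<in> ?G"
      then obtain a b c d where "A = {a<..<b}" "B = {c<..<d}" by auto
      then have "A \<inter> B = {max a c<..<min b d}" by auto
      then show "A \<inter> B \<in> ?G" by auto
    qed
  next
    fix A assume "A \<in> ?G"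
    then obtain a b where "A = {a<..<b}" by auto
    then show "set_lebesgue_integral lebesgue A f = 0" using zero[of a b] by (cases "a < b") (auto simp: set_lebesgue_integral_def)
  next
    fix A assume "A \<in> sigma_sets UNIV ?G" and 0: "set_lebesgue_integral lebesgue A f = 0"
    then have "A \<in> sets lebesgue" by (auto simp: borel_sigma_sets_Ioo[symmetric])
    then have "set_lebesgue_integral lebesgue (A \<union> (UNIV - A)) f =
       set_lebesgue_integral lebesgue A f + set_lebesgue_integral lebesgue (UNIV - A) f"
      by (intro set_integral_Un si) auto
    then show "set_lebesgue_integral lebesgue (UNIV - A) f = 0" using univ 0 by simp
  next
    fix A :: "nat \<Rightarrow> real set"
    assume A: "disjoint_family A" "range A \<subseteq> sigma_sets UNIV ?G"
      and 0: "\<And>i. set_lebesgue_integral lebesgue (A i) f = 0"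
    have "A i \<in> sets lebesgue" for i using A(2) by (auto simp: borel_sigma_sets_Ioo[symmetric])
    then show "set_lebesgue_integral lebesgue (\<Union>i. A i) f = 0"
      using A 0 by (subst lebesgue_integral_countable_add) (auto intro!: si simp: disjoint_family_on_def)
  qed (auto simp: set_lebesgue_integral_def)
  have lebesgue: "set_lebesgue_integral lebesgue A f = 0" if "A \<in> sets lebesgue" for A
  proof -
    obtain S N N' where N: "A = S \<union> N" "N \<subseteq> N'" "N' \<in> null_sets lborel" "S \<in> sets lborel"
      using sets_completionE[OF \<open>A \<in> sets lebesgue\<close>] .
    have "AE x in lebesgue. x \<notin> N'" using N(3) by (intro AE_completion AE_not_in)
    then have "AE x in lebesgue. (x \<in> S) = (x \<in> A)" using N by auto
    then have "set_lebesgue_integral lebesgue A f = set_lebesgue_integral lebesgue S f"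
      using si \<open>A \<in> sets lebesgue\<close> N(4) by (intro set_integral_cong_set)
       (auto simp: set_borel_measurable_def simp del: real_scaleR_def
         intro!: borel_measurable_integrable[OF si[unfolded set_integrable_def]])
    also have "\<dots> = 0" using N(4) by (intro borel) (simp add: borel_sigma_sets_Ioo[symmetric])
    finally show ?thesis .
  qed
  have [measurable]: "f \<in> borel_measurable lebesgue" using f by simp
  have "{x \<in> space lebesgue. 0 < f x} \<in> sets lebesgue" "{x \<in> space lebesgue. f x < 0} \<in> sets lebesgue"
    by measurable
  then have [simp]: "{x. 0 < f x} \<in> sets lebesgue" "{x. f x < 0} \<in> sets lebesgue" by auto
  have "{x. f x > 0} \<in> null_sets lebesgue"
    using lebesgue[of "{x. f x > 0}"] by (intro null_if_pos_func_has_zero_int[OF f]) auto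
  moreover have "{x. f x < 0} \<in> null_sets lebesgue"
    using lebesgue[of "{x. f x < 0}"]
    by (intro null_if_pos_func_has_zero_int[of _ "\<lambda>x. - f x"]) (auto simp: f set_lebesgue_integral_def)
  ultimately have "AE x in lebesgue. x \<notin> {x. f x > 0}" "AE x in lebesgue. x \<notin> {x. f x < 0}"
    by (blast intro: AE_not_in)+
  then show ?thesis by eventually_elim auto
qed

section \<open>Weak derivatives\<close>

text \<open>
  Bumps converge boundedly to the indicator function of an open interval, so the integral of \<open>w\<close>
  over every interval compactly contained in the domain vanishes.
\<close>

lemma fundamental_lemma_of_calculus_of_variations:
  assumes w: "in_Lp_loc 1 {\<alpha><..<\<beta>} w"
    and zero: "\<And>\<psi>. test_function {\<alpha><..<\<beta>} \<psi> \<Longrightarrow> (\<integral>x. w x * \<psi> x \<partial>lebesgue_on {\<alpha><..<\<beta>}) = 0"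
  shows "AE x in lebesgue_on {\<alpha><..<\<beta>}. w x = 0"
proof -
  have interval: "integral\<^sup>L lebesgue (\<lambda>x. indicator {a<..<b} x * w x) = 0"
    if ab: "\<alpha> < a" "b < \<beta>" for a b
  proof -
    have w': "integrable (lebesgue_on {a..b}) w" using in_Lp_loc_1D[OF w ab] .
    have "(\<lambda>n. \<integral>x. w x * bump a b (Suc n) x \<partial>lebesgue_on {a..b}) \<longlonglongrightarrow>
        (\<integral>x. w x * indicator {a<..<b} x \<partial>lebesgue_on {a..b})"
    proof (rule integral_dominated_convergence)
      show "integrable (lebesgue_on {a..b}) (\<lambda>x. \<bar>w x\<bar>)" using w' by simp
      have [measurable]: "w \<in> borel_measurable (lebesgue_on {a..b})" using w' by simp
      have [measurable]: "bump a b n \<in> borel_measurable (lebesgue_on {a..b})" for n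
        by (intro continuous_imp_measurable_on_sets_lebesgue smooth_continuous smooth_bump) auto
      have "{a<..<b} \<in> sets (lebesgue_on {a..b})" by (auto simp: sets_restrict_space)
      then have [measurable]: "(indicator {a<..<b} :: _ \<Rightarrow> real) \<in> borel_measurable (lebesgue_on {a..b})"
        by measurable
      show "(\<lambda>x. w x * indicator {a<..<b} x) \<in> borel_measurable (lebesgue_on {a..b})" by measurable
      show "(\<lambda>x. w x * bump a b (Suc n) x) \<in> borel_measurable (lebesgue_on {a..b})" for n by measurable
      show "AE x in lebesgue_on {a..b}. (\<lambda>n. w x * bump a b (Suc n) x) \<longlonglongrightarrow> w x * indicator {a<..<b} x"
        by (intro AE_I2 tendsto_intros LIMSEQ_Suc bump_tendsto)
      show "AE x in lebesgue_on {a..b}. norm (w x * bump a b (Suc n) x) \<le> \<bar>w x\<bar>" for n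
        using bump_abs_le[of a b "Suc n"] by (auto simp: abs_mult intro!: mult_left_le)
    qed
    moreover have "(\<integral>x. w x * bump a b (Suc n) x \<partial>lebesgue_on {a..b}) = 0" for n
    proof -
      have "(\<integral>x. w x * bump a b (Suc n) x \<partial>lebesgue_on {\<alpha><..<\<beta>}) =
          (\<integral>x. w x * bump a b (Suc n) x \<partial>lebesgue_on {a..b})"
        using ab bump_nonzero_imp_between[of a b "Suc n"]
        by (intro lebesgue_on_subset_if_zero(2)) force+
      then show ?thesis using ab by (simp add: zero test_function_bump)
    qed
    ultimately have "(\<integral>x. w x * indicator {a<..<b} x \<partial>lebesgue_on {a..b}) = 0"
      by (simp add: LIMSEQ_const_iff)
    also have "(\<integral>x. w x * indicator {a<..<b} x \<partial>lebesgue_on {a..b}) =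
        (\<integral>x. indicator {a..b} x *\<^sub>R (w x * indicator {a<..<b} x) \<partial>lebesgue)"
      by (rule integral_restrict_space) simp
    also have "(\<lambda>x. indicator {a..b} x *\<^sub>R (w x * indicator {a<..<b} x)) = (\<lambda>x. indicator {a<..<b} x * w x)"
      by (auto simp: fun_eq_iff indicator_def)
    finally show ?thesis .
  qed
  have inner: "AE x in lebesgue. c < x \<and> x < d \<longrightarrow> w x = 0" if cd: "\<alpha> < c" "d < \<beta>" for c d
  proof -
    let ?f = "\<lambda>x. indicator {c<..<d} x *\<^sub>R w x"
    have "AE x in lebesgue. ?f x = 0"
    proof (rule AE_lebesgue_eq_0_if_interval_integrals_eq_0)
      have "integrable (lebesgue_on {c<..<d}) w"
        by (rule integrable_lebesgue_on_subset[OF in_Lp_loc_1D[OF w cd]]) auto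
      then show "integrable lebesgue ?f"
        by (rule integrable_restrict_space[THEN iffD1, rotated]) simp
      fix a b :: real
      have "(\<lambda>x. indicator {a<..<b} x *\<^sub>R ?f x) = (\<lambda>x. indicator {max a c<..<min b d} x * w x)"
        by (auto simp: fun_eq_iff indicator_def)
      then show "set_lebesgue_integral lebesgue {a<..<b} ?f = 0"
        unfolding set_lebesgue_integral_def using interval[of "max a c" "min b d"] cd by simp
    qed
    then show ?thesis by eventually_elim auto
  qed
  have "AE x in lebesgue. \<forall>n. \<alpha> + 1 / Suc n < x \<and> x < \<beta> - 1 / Suc n \<longrightarrow> w x = 0"
    unfolding AE_all_countable by (intro allI inner) auto
  then have "AE x in lebesgue. x \<in> {\<alpha><..<\<beta>} \<longrightarrow> w x = 0"
  proof eventually_elim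
    case (elim x)
    show ?case
    proof
      assume x: "x \<in> {\<alpha><..<\<beta>}"
      then have "0 < min (x - \<alpha>) (\<beta> - x)" by auto
      then obtain n where "1 / Suc n < min (x - \<alpha>) (\<beta> - x)"
        using nat_approx_posE by blast
      then have "\<alpha> + 1 / Suc n < x \<and> x < \<beta> - 1 / Suc n" by auto
      then show "w x = 0" using elim by blast
    qed
  qed
  then show ?thesis by (subst AE_restrict_space_iff) auto
qed

lemma in_Lp_loc_1_add: "in_Lp_loc 1 \<Omega> f \<Longrightarrow> in_Lp_loc 1 \<Omega> g \<Longrightarrow> in_Lp_loc 1 \<Omega> (\<lambda>x. f x + g x)"
  unfolding in_Lp_loc_def in_Lp_1_iff by (blast intro: Bochner_Integration.integrable_add)

lemma in_Lp_loc_1_uminus: "in_Lp_loc 1 \<Omega> f \<Longrightarrow> in_Lp_loc 1 \<Omega> (\<lambda>x. - f x)"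
  unfolding in_Lp_loc_def in_Lp_1_iff by simp

lemma has_weak_derivD:
  assumes "has_weak_deriv \<Omega> u v"
  shows "in_Lp_loc 1 \<Omega> u" "in_Lp_loc 1 \<Omega> v"
    "test_function \<Omega> \<psi> \<Longrightarrow>
        (\<integral>x. u x * deriv \<psi> x \<partial>lebesgue_on \<Omega>) = - (\<integral>x. v x * \<psi> x \<partial>lebesgue_on \<Omega>)"
  using assms unfolding has_weak_deriv_def by blast+

lemma weak_deriv_unique:
  assumes v: "has_weak_deriv {\<alpha><..<\<beta>} u v" and v': "has_weak_deriv {\<alpha><..<\<beta>} u v'"
  shows "AE x in lebesgue_on {\<alpha><..<\<beta>}. v x = v' x"
proof -
  note L = has_weak_derivD(2)[OF v] has_weak_derivD(2)[OF v']
  have "AE x in lebesgue_on {\<alpha><..<\<beta>}. v x - v' x = 0"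
  proof (rule fundamental_lemma_of_calculus_of_variations)
    show "in_Lp_loc 1 {\<alpha><..<\<beta>} (\<lambda>x. v x - v' x)"
      using in_Lp_loc_1_add[OF L(1) in_Lp_loc_1_uminus[OF L(2)]] by simp
    fix \<psi> assume \<psi>: "test_function {\<alpha><..<\<beta>} \<psi>"
    have "(\<integral>x. v x * \<psi> x - v' x * \<psi> x \<partial>lebesgue_on {\<alpha><..<\<beta>}) =
      (\<integral>x. v x * \<psi> x \<partial>lebesgue_on {\<alpha><..<\<beta>}) - (\<integral>x. v' x * \<psi> x \<partial>lebesgue_on {\<alpha><..<\<beta>})"
      by (intro Bochner_Integration.integral_diff integrable_mult_test_function L \<psi>)
    also have "\<dots> = 0"
      using has_weak_derivD(3)[OF v \<psi>] has_weak_derivD(3)[OF v' \<psi>] by linarith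
    finally show "(\<integral>x. (v x - v' x) * \<psi> x \<partial>lebesgue_on {\<alpha><..<\<beta>}) = 0"
      by (simp add: left_diff_distrib)
  qed
  then show ?thesis by simp
qed

lemma weak_deriv_AE_eq:
  assumes "has_weak_deriv {\<alpha><..<\<beta>} u v"
  shows "AE x in lebesgue_on {\<alpha><..<\<beta>}. weak_deriv {\<alpha><..<\<beta>} u x = v x"
  using weak_deriv_unique[OF _ assms] someI[of "has_weak_deriv {\<alpha><..<\<beta>} u", OF assms]
  unfolding weak_deriv_def by blast

lemma has_weak_deriv_add:
  assumes v: "has_weak_deriv {\<alpha><..<\<beta>} u v" and v': "has_weak_deriv {\<alpha><..<\<beta>} u' v'"
  shows "has_weak_deriv {\<alpha><..<\<beta>} (\<lambda>x. u x + u' x) (\<lambda>x. v x + v' x)"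
  unfolding has_weak_deriv_def
proof (intro conjI allI impI)
  note L = has_weak_derivD(1,2)[OF v] has_weak_derivD(1,2)[OF v']
  show "in_Lp_loc 1 {\<alpha><..<\<beta>} (\<lambda>x. u x + u' x)" "in_Lp_loc 1 {\<alpha><..<\<beta>} (\<lambda>x. v x + v' x)"
    by (intro in_Lp_loc_1_add L)+
  fix \<psi> assume \<psi>: "test_function {\<alpha><..<\<beta>} \<psi>"
  have "(\<integral>x. u x * deriv \<psi> x + u' x * deriv \<psi> x \<partial>lebesgue_on {\<alpha><..<\<beta>}) =
     (\<integral>x. u x * deriv \<psi> x \<partial>lebesgue_on {\<alpha><..<\<beta>}) + (\<integral>x. u' x * deriv \<psi> x \<partial>lebesgue_on {\<alpha><..<\<beta>})"
    by (intro Bochner_Integration.integral_add integrable_mult_test_function L test_function_deriv \<psi>)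
  also have "\<dots> = - ((\<integral>x. v x * \<psi> x \<partial>lebesgue_on {\<alpha><..<\<beta>}) + (\<integral>x. v' x * \<psi> x \<partial>lebesgue_on {\<alpha><..<\<beta>}))"
    using has_weak_derivD(3)[OF v \<psi>] has_weak_derivD(3)[OF v' \<psi>] by linarith
  also have "(\<integral>x. v x * \<psi> x \<partial>lebesgue_on {\<alpha><..<\<beta>}) + (\<integral>x. v' x * \<psi> x \<partial>lebesgue_on {\<alpha><..<\<beta>}) =
     (\<integral>x. v x * \<psi> x + v' x * \<psi> x \<partial>lebesgue_on {\<alpha><..<\<beta>})"
    by (intro Bochner_Integration.integral_add[symmetric] integrable_mult_test_function L \<psi>)
  finally show "(\<integral>x. (u x + u' x) * deriv \<psi> x \<partial>lebesgue_on {\<alpha><..<\<beta>}) =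
      - (\<integral>x. (v x + v' x) * \<psi> x \<partial>lebesgue_on {\<alpha><..<\<beta>})"
    by (simp add: distrib_right)
qed

lemma has_weak_deriv_uminus:
  assumes "has_weak_deriv {\<alpha><..<\<beta>} u v"
  shows "has_weak_deriv {\<alpha><..<\<beta>} (\<lambda>x. - u x) (\<lambda>x. - v x)"
  using assms by (simp add: has_weak_deriv_def in_Lp_loc_1_uminus)

text \<open>
  Integration by parts: the fundamental theorem of calculus for the continuous function \<open>u * \<psi>\<close>
  tolerates finitely many exceptional points.
\<close>

lemma has_weak_deriv_piecewise:
  assumes "finite S" and cont: "continuous_on UNIV u"
    and der: "\<And>x. x \<notin> S \<Longrightarrow> (u has_real_derivative g x) (at x)"
    and g[measurable]: "g \<in> borel_measurable lebesgue" and bound: "\<And>x. \<bar>g x\<bar> \<le> B"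
  shows "has_weak_deriv {\<alpha><..<\<beta>} u g"
  unfolding has_weak_deriv_def
proof (intro conjI allI impI)
  have gL: "integrable (lebesgue_on {a..b}) g" for a b :: real
  proof -
    have "finite_measure (lebesgue_on {a..b})"
      by (rule finite_measure_lebesgue_on[OF lmeasurable_compact[OF compact_Icc]])
    then show ?thesis
    proof (rule finite_measure.integrable_const_bound)
      show "AE x in lebesgue_on {a..b}. norm (g x) \<le> B" using bound by simp
      show "g \<in> borel_measurable (lebesgue_on {a..b})" by (rule measurable_restrict_space1[OF g])
    qed
  qed
  have uL: "integrable (lebesgue_on {a..b}) u" for a b :: real
    by (intro continuous_imp_integrable_real continuous_on_subset[OF cont]) auto
  have loc: "in_Lp_loc 1 {\<alpha><..<\<beta>} f" if f: "\<And>a b. integrable (lebesgue_on {a..b}) f" for f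
    unfolding in_Lp_loc_def in_Lp_1_iff
  proof (intro allI impI)
    fix K assume "compact K \<and> K \<subseteq> {\<alpha><..<\<beta>}"
    then have "compact K" "K \<subseteq> {\<alpha>..\<beta>}" by (auto intro: order_trans[of _ "{\<alpha><..<\<beta>}"])
    then show "integrable (lebesgue_on K) f"
      by (intro integrable_lebesgue_on_subset[OF f[of \<alpha> \<beta>]] fmeasurableD lmeasurable_compact) auto
  qed
  show L: "in_Lp_loc 1 {\<alpha><..<\<beta>} u" "in_Lp_loc 1 {\<alpha><..<\<beta>} g" by (rule loc[OF uL], rule loc[OF gL])
  fix \<psi> assume \<psi>: "test_function {\<alpha><..<\<beta>} \<psi>"
  let ?I = "{\<alpha><..<\<beta>}"
  have i: "integrable (lebesgue_on ?I) (\<lambda>x. u x * deriv \<psi> x)" "integrable (lebesgue_on ?I) (\<lambda>x. g x * \<psi> x)"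
    by (intro integrable_mult_test_function L \<psi> test_function_deriv)+
  have "(\<integral>x. u x * deriv \<psi> x + g x * \<psi> x \<partial>lebesgue_on ?I) = 0"
  proof (cases "\<psi> = (\<lambda>x. 0)")
    case True
    then have "deriv \<psi> x = 0" for x by simp
    then show ?thesis using True by simp
  next
    case False
    then obtain a b where ab: "\<alpha> < a" "a \<le> b" "b < \<beta>" "\<And>x. \<psi> x \<noteq> 0 \<Longrightarrow> a \<le> x \<and> x \<le> b"
      using \<psi> unfolding test_function_Ioo_iff by blast
    define c where "c = (\<alpha> + a) / 2"
    define d where "d = (b + \<beta>) / 2"
    have cd: "\<alpha> < c" "c < a" "b < d" "d < \<beta>" using ab by (auto simp: c_def d_def)
    have 0: "\<psi> x = 0" "deriv \<psi> x = 0" if "x \<notin> {a..b}" for x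
      using ab(4)[of x] deriv_support[of \<psi> a b x, OF ab(4)] that by (meson atLeastAtMost_iff)+
    have z: "u x * deriv \<psi> x + g x * \<psi> x = 0" if "x \<notin> {a..b}" for x using 0[OF that] by simp
    have "((\<lambda>x. u x * deriv \<psi> x + g x * \<psi> x) has_integral (u d * \<psi> d - u c * \<psi> c)) {c..d}"
    proof (rule fundamental_theorem_of_calculus_strong[OF \<open>finite S\<close>])
      fix x assume "x \<in> {c..d} - S"
      then have "((\<lambda>x. u x * \<psi> x) has_real_derivative u x * deriv \<psi> x + g x * \<psi> x) (at x)"
        using DERIV_mult[OF der[of x] smooth_DERIV[OF test_function_smooth[OF \<psi>], of x]]
        by (simp add: mult.commute add.commute)
      then show "((\<lambda>x. u x * \<psi> x) has_vector_derivative u x * deriv \<psi> x + g x * \<psi> x) (at x)"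
        by (simp add: has_real_derivative_iff_has_vector_derivative)
    next
      show "continuous_on {c..d} (\<lambda>x. u x * \<psi> x)"
        by (intro continuous_on_mult continuous_on_subset[OF cont] smooth_continuous test_function_smooth[OF \<psi>]) auto
    next
      show "c \<le> d" using ab cd by linarith
    qed
    then have "integral {c..d} (\<lambda>x. u x * deriv \<psi> x + g x * \<psi> x) = u d * \<psi> d - u c * \<psi> c"
      by (rule integral_unique)
    moreover have "\<psi> d = 0" "\<psi> c = 0" using 0(1)[of c] 0(1)[of d] cd by auto
    ultimately have "integral {c..d} (\<lambda>x. u x * deriv \<psi> x + g x * \<psi> x) = 0" by simp
    moreover have "(\<integral>x. u x * deriv \<psi> x + g x * \<psi> x \<partial>lebesgue_on ?I) =
       (\<integral>x. u x * deriv \<psi> x + g x * \<psi> x \<partial>lebesgue_on {c..d})"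
      by (rule lebesgue_on_subset_if_zero(2)) (use cd in \<open>auto intro!: z\<close>)
    moreover have "(\<integral>x. u x * deriv \<psi> x + g x * \<psi> x \<partial>lebesgue_on {c..d}) =
       integral {c..d} (\<lambda>x. u x * deriv \<psi> x + g x * \<psi> x)"
    proof (rule lebesgue_integral_eq_integral)
      show "integrable (lebesgue_on {c..d}) (\<lambda>x. u x * deriv \<psi> x + g x * \<psi> x)"
        by (rule integrable_lebesgue_on_subset[OF Bochner_Integration.integrable_add[OF i]]) (use cd in auto)
    qed simp
    ultimately show ?thesis by simp
  qed
  then show "(\<integral>x. u x * deriv \<psi> x \<partial>lebesgue_on ?I) = - (\<integral>x. g x * \<psi> x \<partial>lebesgue_on ?I)"
    using Bochner_Integration.integral_add[OF i] by simp
qed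

section \<open>Integrability of powers and the approximating sequences\<close>

lemma powr_add_le:
  fixes p :: real assumes "0 \<le> p"
  shows "\<bar>a + b\<bar> powr p \<le> 2 powr p * (\<bar>a\<bar> powr p + \<bar>b\<bar> powr p)"
proof -
  have "\<bar>a + b\<bar> powr p \<le> (2 * max \<bar>a\<bar> \<bar>b\<bar>) powr p"
    by (rule powr_mono2) (use assms in auto)
  also have "\<dots> = 2 powr p * max \<bar>a\<bar> \<bar>b\<bar> powr p" by (rule powr_mult)
  also have "max \<bar>a\<bar> \<bar>b\<bar> powr p \<le> \<bar>a\<bar> powr p + \<bar>b\<bar> powr p"
    by (cases "\<bar>a\<bar> \<le> \<bar>b\<bar>") (auto simp: max_def)
  finally show ?thesis by simp
qed

lemma in_Lp_add:
  assumes "0 \<le> p" "in_Lp p S f" "in_Lp p S g"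
  shows "in_Lp p S (\<lambda>x. f x + g x)"
proof -
  have [measurable]: "f \<in> borel_measurable (lebesgue_on S)" "g \<in> borel_measurable (lebesgue_on S)"
    and i: "integrable (lebesgue_on S) (\<lambda>x. 2 powr p * (\<bar>f x\<bar> powr p + \<bar>g x\<bar> powr p))"
    using assms by (auto simp: in_Lp_def)
  have "integrable (lebesgue_on S) (\<lambda>x. \<bar>f x + g x\<bar> powr p)"
    by (rule Bochner_Integration.integrable_bound[OF i])
      (use powr_add_le[OF assms(1)] in \<open>auto intro!: AE_I2 order_trans[OF powr_add_le[OF assms(1)]]\<close>)
  then show ?thesis unfolding in_Lp_def by simp
qed

lemma in_Lp_uminus: "in_Lp p S f \<Longrightarrow> in_Lp p S (\<lambda>x. - f x)"
  by (simp add: in_Lp_def)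

lemma in_Lp_bounded:
  assumes "0 \<le> p" "f \<in> borel_measurable (lebesgue_on {\<alpha><..<\<beta>})" "\<And>x. \<alpha> < x \<Longrightarrow> x < \<beta> \<Longrightarrow> \<bar>f x\<bar> \<le> B"
  shows "in_Lp p {\<alpha><..<\<beta>} f"
proof -
  interpret finite_measure "lebesgue_on {\<alpha><..<\<beta>}" by (rule finite_measure_lebesgue_on_Ioo)
  note [measurable] = assms(2)
  have "integrable (lebesgue_on {\<alpha><..<\<beta>}) (\<lambda>x. \<bar>f x\<bar> powr p)"
  proof (rule integrable_const_bound)
    show "AE x in lebesgue_on {\<alpha><..<\<beta>}. norm (\<bar>f x\<bar> powr p) \<le> \<bar>B\<bar> powr p"
      using assms(3) by (intro AE_I2) (force simp: intro!: powr_mono2 assms(1))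
  qed measurable
  then show ?thesis using assms(2) by (simp add: in_Lp_def)
qed

text \<open>
  An elementary substitute for the inequality between the \<open>L\<^sup>1\<close> and the \<open>L\<^sup>p\<close> norm on a bounded
  interval. Integrated, with \<open>s\<close> a bound for the \<open>L\<^sup>p\<close> norm, both terms are multiples of \<open>s\<close>.
\<close>

lemma le_scaled_powr:
  fixes p s y :: real
  assumes "1 \<le> p" "0 < s" "0 \<le> y"
  shows "y \<le> s + s powr (1 - p) * y powr p"
proof (cases "y \<le> s")
  case True
  then show ?thesis by (simp add: add_increasing2)
next
  case False
  have "y powr (1 - p) \<le> s powr (1 - p)"
    using False assms by (intro powr_mono2') auto
  then have "y powr (1 - p) * y powr p \<le> s powr (1 - p) * y powr p" by (rule mult_right_mono) simp
  moreover have "y powr (1 - p) * y powr p = y" using False assms by (simp flip: powr_add)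
  ultimately show ?thesis using assms by simp
qed

lemma in_Lp_integrable:
  assumes "1 \<le> p" "in_Lp p {\<alpha><..<\<beta>} f"
  shows "integrable (lebesgue_on {\<alpha><..<\<beta>}) f"
proof -
  interpret finite_measure "lebesgue_on {\<alpha><..<\<beta>}" by (rule finite_measure_lebesgue_on_Ioo)
  have f: "f \<in> borel_measurable (lebesgue_on {\<alpha><..<\<beta>})"
     "integrable (lebesgue_on {\<alpha><..<\<beta>}) (\<lambda>x. 1 + 1 * \<bar>f x\<bar> powr p)"
    using assms by (auto simp: in_Lp_def)
  show ?thesis
    by (rule Bochner_Integration.integrable_bound[OF f(2) f(1)])
      (use le_scaled_powr[OF assms(1), of 1] in auto)
qed

lemma integral_abs_le_of_integral_powr_le:
  assumes "1 \<le> p" "in_Lp p {\<alpha><..<\<beta>} f" "0 < s" "\<alpha> < \<beta>"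
    and le: "(\<integral>x. \<bar>f x\<bar> powr p \<partial>lebesgue_on {\<alpha><..<\<beta>}) \<le> s powr p"
  shows "(\<integral>x. \<bar>f x\<bar> \<partial>lebesgue_on {\<alpha><..<\<beta>}) \<le> s * (\<beta> - \<alpha> + 1)"
proof -
  interpret finite_measure "lebesgue_on {\<alpha><..<\<beta>}" by (rule finite_measure_lebesgue_on_Ioo)
  have i: "integrable (lebesgue_on {\<alpha><..<\<beta>}) (\<lambda>x. \<bar>f x\<bar> powr p)" using assms by (auto simp: in_Lp_def)
  have "(\<integral>x. \<bar>f x\<bar> \<partial>lebesgue_on {\<alpha><..<\<beta>}) \<le> (\<integral>x. s + s powr (1 - p) * \<bar>f x\<bar> powr p \<partial>lebesgue_on {\<alpha><..<\<beta>})"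
    by (intro integral_mono integrable_abs in_Lp_integrable[OF assms(1,2)] le_scaled_powr
          Bochner_Integration.integrable_add integrable_const integrable_mult_right i assms) auto
  also have "\<dots> = s * (\<beta> - \<alpha>) + s powr (1 - p) * (\<integral>x. \<bar>f x\<bar> powr p \<partial>lebesgue_on {\<alpha><..<\<beta>})"
    using i assms(4) by (simp add: measure_restrict_space)
  also have "\<dots> \<le> s * (\<beta> - \<alpha>) + s powr (1 - p) * s powr p"
    by (intro add_left_mono mult_left_mono le) simp
  also have "s powr (1 - p) * s powr p = s" using assms(3) by (simp flip: powr_add)
  finally show ?thesis by (simp add: algebra_simps)
qed

lemma in_Lp_imp_in_Lp_loc:
  assumes "in_Lp p {\<alpha><..<\<beta>} f" shows "in_Lp_loc p {\<alpha><..<\<beta>} f"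
  unfolding in_Lp_loc_def
proof (intro allI impI)
  fix K assume K: "compact K \<and> K \<subseteq> {\<alpha><..<\<beta>}"
  then have K': "K \<in> sets lebesgue" by (intro fmeasurableD lmeasurable_compact) simp
  have "integrable (lebesgue_on K) (\<lambda>x. \<bar>f x\<bar> powr p)"
    by (rule integrable_lebesgue_on_subset[of "{\<alpha><..<\<beta>}"]) (use assms K K' in \<open>simp_all add: in_Lp_def\<close>)
  moreover have "f \<in> borel_measurable (lebesgue_on K)"
    by (rule measurable_restrict_mono[where A="{\<alpha><..<\<beta>}"]) (use assms K in \<open>simp_all add: in_Lp_def\<close>)
  ultimately show "in_Lp p K f" by (simp add: in_Lp_def)
qed

lemma has_weak_deriv_test_function:
  assumes "test_function {\<alpha><..<\<beta>} \<psi>" shows "has_weak_deriv {\<alpha><..<\<beta>} \<psi> (deriv \<psi>)"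
proof -
  note \<psi> = test_function_smooth[OF assms]
  obtain B where B: "\<And>x. \<bar>deriv \<psi> x\<bar> \<le> B" using test_function_bounded[OF test_function_deriv[OF assms]] by metis
  have m: "deriv \<psi> \<in> borel_measurable lebesgue" by (rule smooth_measurable[OF smooth_deriv[OF \<psi>]])
  show ?thesis
    by (rule has_weak_deriv_piecewise[OF finite.emptyI smooth_continuous[OF \<psi>] smooth_DERIV[OF \<psi>] m B])
qed

lemma in_Lp_test_function:
  assumes "test_function {\<alpha><..<\<beta>} \<psi>" "0 \<le> p" shows "in_Lp p {\<alpha><..<\<beta>} \<psi>"
proof -
  obtain B where "\<And>x. \<bar>\<psi> x\<bar> \<le> B" using test_function_bounded[OF assms(1)] by metis
  then show ?thesis
    by (intro in_Lp_bounded[of _ _ _ _ B] assms continuous_imp_measurable_on_sets_lebesgue smooth_continuous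
      test_function_smooth[OF assms(1)]) auto
qed

lemma borel_measurable_lebesgue_on_AE:
  fixes f g :: "real \<Rightarrow> real"
  assumes "S \<in> sets lebesgue" "f \<in> borel_measurable (lebesgue_on S)" "AE x in lebesgue_on S. f x = g x"
  shows "g \<in> borel_measurable (lebesgue_on S)"
proof -
  have "AE x in lebesgue. x \<in> S \<longrightarrow> f x = g x"
    using assms(1,3) by (subst (asm) AE_restrict_space_iff) auto
  then have "AE x in lebesgue. indicator S x *\<^sub>R f x = indicator S x *\<^sub>R g x"
    by eventually_elim (auto simp: indicator_def)
  moreover have "(\<lambda>x. indicator S x *\<^sub>R f x) \<in> borel_measurable lebesgue"
    by (rule borel_measurable_restrict_space_iff[THEN iffD1]) (use assms in auto)
  ultimately have "(\<lambda>x. indicator S x *\<^sub>R g x) \<in> borel_measurable lebesgue"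
    by (rule borel_measurable_AE[rotated])
  then show ?thesis
    by (rule borel_measurable_restrict_space_iff[THEN iffD2, rotated]) (use assms in auto)
qed

lemma borel_measurable_weak_deriv:
  assumes "has_weak_deriv {\<alpha><..<\<beta>} u v" "v \<in> borel_measurable (lebesgue_on {\<alpha><..<\<beta>})"
  shows "weak_deriv {\<alpha><..<\<beta>} u \<in> borel_measurable (lebesgue_on {\<alpha><..<\<beta>})"
  using weak_deriv_AE_eq[OF assms(1)]
  by (intro borel_measurable_lebesgue_on_AE[OF _ assms(2)]) (auto simp: eq_commute)

text \<open>
  Only convergence in \<open>L\<^sup>1\<close> is kept from the definition of \<open>W1p_0\<close>; it is enough to pass to the limit
  in integrals against bounded functions.
\<close>

lemma W1p_0_approx:
  assumes p: "1 < p" and I: "\<alpha> < \<beta>" and \<phi>: "\<phi> \<in> W1p_0 p {\<alpha><..<\<beta>}"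
  obtains v \<psi> where "has_weak_deriv {\<alpha><..<\<beta>} \<phi> v" "in_Lp p {\<alpha><..<\<beta>} \<phi>" "in_Lp p {\<alpha><..<\<beta>} v"
    "\<And>n::nat. test_function {\<alpha><..<\<beta>} (\<psi> n)"
    "(\<lambda>n. \<integral>x. \<bar>\<phi> x - \<psi> n x\<bar> \<partial>lebesgue_on {\<alpha><..<\<beta>}) \<longlonglongrightarrow> 0"
    "(\<lambda>n. \<integral>x. \<bar>v x - deriv (\<psi> n) x\<bar> \<partial>lebesgue_on {\<alpha><..<\<beta>}) \<longlonglongrightarrow> 0"
proof -
  let ?I = "{\<alpha><..<\<beta>}"
  obtain v where v: "has_weak_deriv ?I \<phi> v" "in_Lp p ?I v" and \<phi>L: "in_Lp p ?I \<phi>"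
    using \<phi> by (auto simp: W1p_0_def W1p_def)
  have "\<forall>n. \<exists>\<psi>. test_function ?I \<psi> \<and> W1p_norm p ?I (\<lambda>x. \<phi> x - \<psi> x) < 1 / Suc n"
    using \<phi> by (simp add: W1p_0_def)
  then obtain \<psi> where \<psi>: "\<And>n. test_function ?I (\<psi> n)"
    "\<And>n. W1p_norm p ?I (\<lambda>x. \<phi> x - \<psi> n x) < 1 / Suc n" by metis
  have L: "in_Lp p ?I (\<lambda>x. \<phi> x - \<psi> n x)" "in_Lp p ?I (\<lambda>x. v x - deriv (\<psi> n) x)" for n
    using in_Lp_add[OF _ \<phi>L in_Lp_uminus[OF in_Lp_test_function[OF \<psi>(1)[of n]]]]
      in_Lp_add[OF _ v(2) in_Lp_uminus[OF in_Lp_test_function[OF test_function_deriv[OF \<psi>(1)[of n]]]]] p by auto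
  have D: "has_weak_deriv ?I (\<lambda>x. \<phi> x - \<psi> n x) (\<lambda>x. v x - deriv (\<psi> n) x)" for n
    using has_weak_deriv_add[OF v(1) has_weak_deriv_uminus[OF has_weak_deriv_test_function[OF \<psi>(1)[of n]]]] by simp
  have bound: "(\<integral>x. \<bar>\<phi> x - \<psi> n x\<bar> \<partial>lebesgue_on ?I) \<le> (1 / Suc n) * (\<beta> - \<alpha> + 1)"
    "(\<integral>x. \<bar>v x - deriv (\<psi> n) x\<bar> \<partial>lebesgue_on ?I) \<le> (1 / Suc n) * (\<beta> - \<alpha> + 1)" for n
  proof -
    let ?u = "\<lambda>x. \<phi> x - \<psi> n x" and ?v = "\<lambda>x. v x - deriv (\<psi> n) x"
    have i: "integrable (lebesgue_on ?I) (\<lambda>x. \<bar>?u x\<bar> powr p)" "integrable (lebesgue_on ?I) (\<lambda>x. \<bar>?v x\<bar> powr p)"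
      using L[of n] by (auto simp: in_Lp_def)
    have ae: "AE x in lebesgue_on ?I. \<bar>?u x\<bar> powr p + \<bar>weak_deriv ?I ?u x\<bar> powr p = \<bar>?u x\<bar> powr p + \<bar>?v x\<bar> powr p"
      using weak_deriv_AE_eq[OF D[of n]] by eventually_elim simp
    then have ae': "AE x in lebesgue_on ?I. \<bar>?u x\<bar> powr p + \<bar>?v x\<bar> powr p = \<bar>?u x\<bar> powr p + \<bar>weak_deriv ?I ?u x\<bar> powr p"
      by eventually_elim simp
    define N where "N = (\<integral>x. \<bar>?u x\<bar> powr p + \<bar>?v x\<bar> powr p \<partial>lebesgue_on ?I)"
    have "?u \<in> borel_measurable (lebesgue_on ?I)" "?v \<in> borel_measurable (lebesgue_on ?I)"
      using L[of n] unfolding in_Lp_def by blast+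
    note [measurable] = this borel_measurable_weak_deriv[OF D[of n] this(2)]
    have "N = (\<integral>x. \<bar>?u x\<bar> powr p + \<bar>weak_deriv ?I ?u x\<bar> powr p \<partial>lebesgue_on ?I)"
      unfolding N_def by (rule integral_cong_AE[OF _ _ ae']) measurable
    then have "N powr (1 / p) < 1 / Suc n" using \<psi>(2)[of n] by (simp add: W1p_norm_def)
    moreover have "0 \<le> N" unfolding N_def by (intro integral_nonneg_AE) auto
    ultimately have "N \<le> (1 / Suc n) powr p"
      using powr_mono2[of p "N powr (1/p)" "1 / Suc n"] p by (simp add: powr_powr)
    moreover have "(\<integral>x. \<bar>?u x\<bar> powr p \<partial>lebesgue_on ?I) \<le> N" "(\<integral>x. \<bar>?v x\<bar> powr p \<partial>lebesgue_on ?I) \<le> N"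
      unfolding N_def using i by (auto intro!: integral_mono)
    ultimately show "(\<integral>x. \<bar>\<phi> x - \<psi> n x\<bar> \<partial>lebesgue_on ?I) \<le> (1 / Suc n) * (\<beta> - \<alpha> + 1)"
    "(\<integral>x. \<bar>v x - deriv (\<psi> n) x\<bar> \<partial>lebesgue_on ?I) \<le> (1 / Suc n) * (\<beta> - \<alpha> + 1)"
      using integral_abs_le_of_integral_powr_le[OF _ L(1)[of n] _ I, of "1 / Suc n"]
        integral_abs_le_of_integral_powr_le[OF _ L(2)[of n] _ I, of "1 / Suc n"] p by auto
  qed
  have lim: "(\<lambda>n. (1 / Suc n) * (\<beta> - \<alpha> + 1)) \<longlonglongrightarrow> 0" by real_asymp
  show ?thesis
  proof (rule that[OF v(1) \<phi>L v(2) \<psi>(1)])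
    show "(\<lambda>n. \<integral>x. \<bar>\<phi> x - \<psi> n x\<bar> \<partial>lebesgue_on ?I) \<longlonglongrightarrow> 0"
      by (rule tendsto_sandwich[OF _ _ tendsto_const lim]) (use bound in auto)
    show "(\<lambda>n. \<integral>x. \<bar>v x - deriv (\<psi> n) x\<bar> \<partial>lebesgue_on ?I) \<longlonglongrightarrow> 0"
      by (rule tendsto_sandwich[OF _ _ tendsto_const lim]) (use bound in auto)
  qed
qed

section \<open>Vanishing of the integral of the derivative\<close>

lemma continuous_antiderivative:
  fixes h :: "real \<Rightarrow> real"
  assumes "continuous_on UNIV h"
  obtains H where "\<And>x. (H has_real_derivative h x) (at x)"
proof -
  have "\<exists>H. \<forall>x::real. -\<infinity> < ereal x \<longrightarrow> ereal x < \<infinity> \<longrightarrow> (H has_vector_derivative h x) (at x)"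
    by (rule einterval_antiderivative) (use assms in \<open>auto simp: continuous_on_eq_continuous_at\<close>)
  then show ?thesis
    using that by (auto simp: has_real_derivative_iff_has_vector_derivative)
qed

text \<open>
  The integrand is the derivative of \<open>H \<circ> \<psi>\<close>, where \<open>H' = h\<close>, and \<open>H \<circ> \<psi>\<close> takes the value \<open>H 0\<close>
  near both end points.
\<close>

lemma integral_test_function_chain_eq_0:
  assumes h: "continuous_on UNIV h" and \<psi>: "test_function {\<alpha><..<\<beta>} \<psi>" and I: "\<alpha> < \<beta>"
  shows "(\<integral>x. h (\<psi> x) * deriv \<psi> x \<partial>lebesgue_on {\<alpha><..<\<beta>}) = 0"
proof -
  obtain H where H: "\<And>x. (H has_real_derivative h x) (at x)"
    by (rule continuous_antiderivative[OF h]) blast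
  obtain a b where ab: "\<alpha> < a" "a \<le> b" "b < \<beta>" "\<And>x. \<psi> x \<noteq> 0 \<Longrightarrow> a \<le> x \<and> x \<le> b"
    "\<And>x. x < a \<or> b < x \<Longrightarrow> \<psi> x = 0"
    using test_function_supportE[OF \<psi> I] by blast
  define c where "c = (\<alpha> + a) / 2"
  define d where "d = (b + \<beta>) / 2"
  have cd: "\<alpha> < c" "c < a" "b < d" "d < \<beta>" using ab by (auto simp: c_def d_def)
  note s = test_function_smooth[OF \<psi>]
  have D: "((\<lambda>x. H (\<psi> x)) has_real_derivative h (\<psi> x) * deriv \<psi> x) (at x)" for x
    by (rule DERIV_chain2[OF H smooth_DERIV[OF s]])
  have cont: "continuous_on {c..d} (\<lambda>x. h (\<psi> x) * deriv \<psi> x)"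
    by (intro continuous_on_mult continuous_on_compose2[OF h] smooth_continuous s smooth_deriv) auto
  have "((\<lambda>x. h (\<psi> x) * deriv \<psi> x) has_integral (H (\<psi> d) - H (\<psi> c))) {c..d}"
  proof (rule fundamental_theorem_of_calculus)
    show "c \<le> d" using ab cd by linarith
    show "((\<lambda>x. H (\<psi> x)) has_vector_derivative h (\<psi> x) * deriv \<psi> x) (at x within {c..d})" for x
      using D[of x] has_vector_derivative_at_within
      unfolding has_real_derivative_iff_has_vector_derivative by blast
  qed
  then have "integral {c..d} (\<lambda>x. h (\<psi> x) * deriv \<psi> x) = H (\<psi> d) - H (\<psi> c)" by (rule integral_unique)
  moreover have "\<psi> d = 0" "\<psi> c = 0" using ab(5)[of c] ab(5)[of d] cd by auto
  ultimately have "integral {c..d} (\<lambda>x. h (\<psi> x) * deriv \<psi> x) = 0" by simp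
  moreover have "(\<integral>x. h (\<psi> x) * deriv \<psi> x \<partial>lebesgue_on {c..d}) = integral {c..d} (\<lambda>x. h (\<psi> x) * deriv \<psi> x)"
    by (rule lebesgue_integral_eq_integral[OF continuous_imp_integrable_real[OF cont]]) simp
  moreover have "(\<integral>x. h (\<psi> x) * deriv \<psi> x \<partial>lebesgue_on {\<alpha><..<\<beta>}) = (\<integral>x. h (\<psi> x) * deriv \<psi> x \<partial>lebesgue_on {c..d})"
  proof (rule lebesgue_on_subset_if_zero(2))
    show "h (\<psi> x) * deriv \<psi> x = 0" if "x \<in> {\<alpha><..<\<beta>} - {c..d}" for x
    proof -
      have "\<not> (a \<le> x \<and> x \<le> b)" using that cd by auto
      then have "deriv \<psi> x = 0" using deriv_support[of \<psi> a b x, OF ab(4)] by blast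
      then show ?thesis by simp
    qed
  qed (use cd in auto)
  ultimately show ?thesis by simp
qed

text \<open>
  The same identity for the limit of the test functions. A subsequence converges almost everywhere, so
  \<open>h (\<psi> n) * v\<close> converges in \<open>L\<^sup>1\<close> to \<open>h \<phi> * v\<close>, and replacing \<open>v\<close> by the derivative of \<open>\<psi> n\<close> costs at
  most the \<open>L\<^sup>1\<close> distance of the derivatives.
\<close>

lemma integral_chain_eq_0_by_approximation:
  assumes p: "1 < p" and I: "\<alpha> < \<beta>"
    and v: "integrable (lebesgue_on {\<alpha><..<\<beta>}) v"
    and \<phi>: "integrable (lebesgue_on {\<alpha><..<\<beta>}) \<phi>"
    and \<psi>: "\<And>n::nat. test_function {\<alpha><..<\<beta>} (\<psi> n)"
    and lim: "(\<lambda>n. \<integral>x. \<bar>\<phi> x - \<psi> n x\<bar> \<partial>lebesgue_on {\<alpha><..<\<beta>}) \<longlonglongrightarrow> 0"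
    and lim': "(\<lambda>n. \<integral>x. \<bar>v x - deriv (\<psi> n) x\<bar> \<partial>lebesgue_on {\<alpha><..<\<beta>}) \<longlonglongrightarrow> 0"
    and h: "continuous_on UNIV h" and h1: "\<And>y. \<bar>h y\<bar> \<le> 1"
  shows "(\<integral>x. h (\<phi> x) * v x \<partial>lebesgue_on {\<alpha><..<\<beta>}) = 0"
proof -
  let ?M = "lebesgue_on {\<alpha><..<\<beta>}"
  have \<psi>i: "integrable ?M (\<psi> n)" "integrable ?M (deriv (\<psi> n))" for n
    using p by (auto intro!: in_Lp_integrable[of 1] in_Lp_test_function test_function_deriv \<psi>)
  have "\<exists>r::nat\<Rightarrow>nat. strict_mono r \<and> (AE x in ?M. (\<lambda>n. \<phi> x - \<psi> (r n) x) \<longlonglongrightarrow> 0)"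
    by (rule tendsto_L1_AE_subseq) (use \<phi> \<psi>i lim in auto)
  then obtain r :: "nat \<Rightarrow> nat" where r: "strict_mono r"
    and ae0: "AE x in ?M. (\<lambda>n. \<phi> x - \<psi> (r n) x) \<longlonglongrightarrow> 0" by blast
  have ae: "AE x in ?M. (\<lambda>n. \<psi> (r n) x) \<longlonglongrightarrow> \<phi> x"
    using ae0
  proof eventually_elim
    case (elim x)
    then show ?case using tendsto_diff[OF tendsto_const[of "\<phi> x"] elim] by simp
  qed
  have [measurable]: "h \<in> borel_measurable borel" using borel_measurable_continuous_onI[OF h] .
  note [measurable] = borel_measurable_integrable[OF v] borel_measurable_integrable[OF \<phi>]
    borel_measurable_integrable[OF \<psi>i(1)] borel_measurable_integrable[OF \<psi>i(2)]
  have hv: "integrable ?M (\<lambda>x. h (\<psi> n x) * w x)" if w: "integrable ?M w" for n w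
  proof (rule Bochner_Integration.integrable_bound[OF w])
    note [measurable] = borel_measurable_integrable[OF w]
    show "(\<lambda>x. h (\<psi> n x) * w x) \<in> borel_measurable ?M" by measurable
  qed (use h1 in \<open>auto simp: abs_mult intro!: mult_left_le_one_le\<close>)
  have "(\<lambda>n. \<integral>x. h (\<psi> (r n) x) * v x \<partial>?M) \<longlonglongrightarrow> (\<integral>x. h (\<phi> x) * v x \<partial>?M)"
  proof (rule integral_dominated_convergence)
    show "integrable ?M (\<lambda>x. \<bar>v x\<bar>)" using v by simp
    show "AE x in ?M. (\<lambda>n. h (\<psi> (r n) x) * v x) \<longlonglongrightarrow> h (\<phi> x) * v x"
      using ae
    proof eventually_elim
      case (elim x)
      have "isCont h (\<phi> x)" using h by (simp add: continuous_on_eq_continuous_at)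
      from isCont_tendsto_compose[OF this elim] show ?case by (intro tendsto_intros)
    qed
    show "AE x in ?M. norm (h (\<psi> (r n) x) * v x) \<le> \<bar>v x\<bar>" for n
      using h1 by (auto simp: abs_mult intro!: mult_left_le_one_le)
  qed measurable
  moreover have "(\<lambda>n. \<integral>x. h (\<psi> (r n) x) * v x \<partial>?M) \<longlonglongrightarrow> 0"
  proof (rule Lim_null_comparison)
    show "(\<lambda>n. \<integral>x. \<bar>v x - deriv (\<psi> (r n)) x\<bar> \<partial>?M) \<longlonglongrightarrow> 0"
      using LIMSEQ_subseq_LIMSEQ[OF lim' r] by (simp add: o_def)
    have "norm (\<integral>x. h (\<psi> n x) * v x \<partial>?M) \<le> (\<integral>x. \<bar>v x - deriv (\<psi> n) x\<bar> \<partial>?M)" for n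
    proof -
      have "(\<integral>x. h (\<psi> n x) * v x \<partial>?M) = (\<integral>x. h (\<psi> n x) * v x \<partial>?M) - (\<integral>x. h (\<psi> n x) * deriv (\<psi> n) x \<partial>?M)"
        by (simp add: integral_test_function_chain_eq_0[OF h \<psi> I])
      also have "\<dots> = (\<integral>x. h (\<psi> n x) * v x - h (\<psi> n x) * deriv (\<psi> n) x \<partial>?M)"
        by (intro Bochner_Integration.integral_diff[symmetric] hv v \<psi>i)
      also have "\<dots> = (\<integral>x. h (\<psi> n x) * (v x - deriv (\<psi> n) x) \<partial>?M)"
        by (simp add: right_diff_distrib)
      also have "norm \<dots> \<le> (\<integral>x. norm (h (\<psi> n x) * (v x - deriv (\<psi> n) x)) \<partial>?M)"
        by (rule integral_norm_bound)
      also have "\<dots> \<le> (\<integral>x. \<bar>v x - deriv (\<psi> n) x\<bar> \<partial>?M)"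
        by (intro integral_mono integrable_norm integrable_abs hv Bochner_Integration.integrable_diff v \<psi>i)
          (use h1 in \<open>auto simp: abs_mult intro!: mult_left_le_one_le\<close>)
      finally show ?thesis .
    qed
    then show "eventually (\<lambda>n. norm (\<integral>x. h (\<psi> (r n) x) * v x \<partial>?M) \<le> (\<integral>x. \<bar>v x - deriv (\<psi> (r n)) x\<bar> \<partial>?M)) sequentially"
      by simp
  qed
  ultimately show ?thesis by (rule LIMSEQ_unique)
qed

text \<open>
  The functions \<open>min 1 (n * \<bar>y\<bar>)\<close> are continuous and increase to the indicator function of
  \<open>y \<noteq> 0\<close>, which gives the last property from the chain rule above. It replaces the decomposition of
  the set \<open>\<phi> \<noteq> 0\<close> into intervals at whose end points \<open>\<phi>\<close> vanishes, and works for every representative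
  of \<open>\<phi>\<close>.
\<close>

lemma W1p_0_weak_derivE:
  assumes p: "1 < p" and I: "\<alpha> < \<beta>" and \<phi>: "\<phi> \<in> W1p_0 p {\<alpha><..<\<beta>}"
  obtains v where "has_weak_deriv {\<alpha><..<\<beta>} \<phi> v" "in_Lp p {\<alpha><..<\<beta>} \<phi>" "in_Lp p {\<alpha><..<\<beta>} v"
    "(\<integral>x. indicator {x. \<phi> x \<noteq> 0} x * v x \<partial>lebesgue_on {\<alpha><..<\<beta>}) = 0"
proof -
  let ?M = "lebesgue_on {\<alpha><..<\<beta>}"
  from W1p_0_approx[OF assms] obtain v \<psi>
    where v: "has_weak_deriv {\<alpha><..<\<beta>} \<phi> v" "in_Lp p {\<alpha><..<\<beta>} \<phi>" "in_Lp p {\<alpha><..<\<beta>} v"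
    and \<psi>: "\<And>n::nat. test_function {\<alpha><..<\<beta>} (\<psi> n)"
    "(\<lambda>n. \<integral>x. \<bar>\<phi> x - \<psi> n x\<bar> \<partial>?M) \<longlonglongrightarrow> 0"
    "(\<lambda>n. \<integral>x. \<bar>v x - deriv (\<psi> n) x\<bar> \<partial>?M) \<longlonglongrightarrow> 0" by blast
  have i: "integrable ?M v" "integrable ?M \<phi>" using in_Lp_integrable[OF less_imp_le[OF p]] v(2,3) by blast+
  note [measurable] = borel_measurable_integrable[OF i(1)] borel_measurable_integrable[OF i(2)]
  define h where "h n y = min 1 (real n * \<bar>y\<bar>)" for n :: nat and y :: real
  have h: "continuous_on UNIV (h n)" "\<bar>h n y\<bar> \<le> 1" for n y
    unfolding h_def by (auto intro!: continuous_intros)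
  have [measurable]: "h n \<in> borel_measurable borel" for n using borel_measurable_continuous_onI[OF h(1)] .
  have 0: "(\<integral>x. h n (\<phi> x) * v x \<partial>?M) = 0" for n
    by (rule integral_chain_eq_0_by_approximation[OF p I i \<psi> h])
  have "(\<lambda>n. \<integral>x. h n (\<phi> x) * v x \<partial>?M) \<longlonglongrightarrow> (\<integral>x. indicator {x. \<phi> x \<noteq> 0} x * v x \<partial>?M)"
  proof (rule integral_dominated_convergence)
    show "integrable ?M (\<lambda>x. \<bar>v x\<bar>)" using i by simp
    have "(\<lambda>n. h n y) \<longlonglongrightarrow> indicator {y. y \<noteq> 0} y" for y
    proof (cases "y = 0")
      case False
      then have "0 < \<bar>y\<bar>" by simp
      then have "eventually (\<lambda>n. 1 \<le> real n * \<bar>y\<bar>) sequentially" by real_asymp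
      then have "eventually (\<lambda>n. h n y = indicator {y. y \<noteq> 0} y) sequentially"
        by eventually_elim (use False in \<open>auto simp: h_def\<close>)
      then show ?thesis by (rule tendsto_eventually)
    qed (simp add: h_def)
    from this[of "\<phi> _"] have "(\<lambda>n. h n (\<phi> x)) \<longlonglongrightarrow> indicator {x. \<phi> x \<noteq> 0} x" for x
      by (simp add: indicator_def)
    then show "AE x in ?M. (\<lambda>n. h n (\<phi> x) * v x) \<longlonglongrightarrow> indicator {x. \<phi> x \<noteq> 0} x * v x"
      by (intro AE_I2 tendsto_intros)
    show "AE x in ?M. norm (h n (\<phi> x) * v x) \<le> \<bar>v x\<bar>" for n
      using h(2) by (auto simp: abs_mult intro!: mult_left_le_one_le)
  qed measurable
  then have "(\<integral>x. indicator {x. \<phi> x \<noteq> 0} x * v x \<partial>?M) = 0" by (simp add: 0 LIMSEQ_const_iff)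
  then show ?thesis by (rule that[OF v])
qed

text \<open>
  For positive \<open>y\<close> this is Young's inequality for \<open>y\<close> and \<open>d powr (p - 1)\<close>; the right-hand side is
  nonnegative while the left-hand side is not positive otherwise.
\<close>

lemma powr_above_tangent:
  fixes p d y :: real
  assumes "1 < p" "0 < d"
  shows "p * d powr (p - 1) * y - (p - 1) * d powr p \<le> \<bar>y\<bar> powr p"
proof (cases "0 < y")
  case True
  have "(y powr p) powr (1/p) * (d powr p) powr (1 - 1/p) \<le> (1/p) * y powr p + (1 - 1/p) * d powr p"
    using assms True by (intro Youngs_inequality_0) auto
  moreover have "(y powr p) powr (1/p) = y" using assms True by (simp add: powr_powr)
  moreover have "(d powr p) powr (1 - 1/p) = d powr (p - 1)" using assms by (simp add: powr_powr algebra_simps)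
  ultimately show ?thesis using assms True by (simp add: field_simps)
next
  case False
  then have "p * d powr (p - 1) * y \<le> 0" "0 \<le> (p - 1) * d powr p"
    using assms by (auto simp: mult_nonneg_nonpos)
  then show ?thesis using powr_ge_zero[of "\<bar>y\<bar>" p] by linarith
qed

section \<open>Quasiminimizers with bounded slopes\<close>

lemma energy_eq_integral:
  assumes u: "has_weak_deriv {\<alpha><..<\<beta>} u g" "in_Lp p {\<alpha><..<\<beta>} g"
    and \<phi>[measurable]: "\<phi> \<in> borel_measurable (lebesgue_on {\<alpha><..<\<beta>})"
  shows "energy p {\<alpha><..<\<beta>} \<phi> u =
     ennreal (\<integral>x. indicator {x. \<phi> x \<noteq> 0} x * \<bar>g x\<bar> powr p \<partial>lebesgue_on {\<alpha><..<\<beta>})"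
    and "integrable (lebesgue_on {\<alpha><..<\<beta>}) (\<lambda>x. indicator {x. \<phi> x \<noteq> 0} x * \<bar>g x\<bar> powr p)"
proof -
  let ?I = "{\<alpha><..<\<beta>}" and ?G = "{x. \<phi> x \<noteq> 0}"
  have [measurable]: "g \<in> borel_measurable (lebesgue_on ?I)"
    and i: "integrable (lebesgue_on ?I) (\<lambda>x. \<bar>g x\<bar> powr p)" using u by (auto simp: in_Lp_def)
  show int: "integrable (lebesgue_on ?I) (\<lambda>x. indicator ?G x * \<bar>g x\<bar> powr p)"
    by (rule Bochner_Integration.integrable_bound[OF i]) (auto simp: indicator_def)
  have "energy p ?I \<phi> u = (\<integral>\<^sup>+x. (ennreal (\<bar>weak_deriv ?I u x\<bar> powr p) * indicator ?G x) * indicator ?I x \<partial>lebesgue)"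
    unfolding energy_def by (intro nn_integral_cong) (auto simp: indicator_def)
  also have "\<dots> = (\<integral>\<^sup>+x. ennreal (\<bar>weak_deriv ?I u x\<bar> powr p) * indicator ?G x \<partial>lebesgue_on ?I)"
    by (rule nn_integral_restrict_space[symmetric]) simp
  also have "\<dots> = (\<integral>\<^sup>+x. ennreal (indicator ?G x * \<bar>g x\<bar> powr p) \<partial>lebesgue_on ?I)"
  proof (rule nn_integral_cong_AE)
    show "AE x in lebesgue_on ?I. ennreal (\<bar>weak_deriv ?I u x\<bar> powr p) * indicator ?G x =
        ennreal (indicator ?G x * \<bar>g x\<bar> powr p)"
      using weak_deriv_AE_eq[OF u(1)] by eventually_elim (auto simp: indicator_def)
  qed
  also have "\<dots> = ennreal (\<integral>x. indicator ?G x * \<bar>g x\<bar> powr p \<partial>lebesgue_on ?I)"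
    by (rule nn_integral_eq_integral[OF int]) auto
  finally show "energy p ?I \<phi> u = ennreal (\<integral>x. indicator ?G x * \<bar>g x\<bar> powr p \<partial>lebesgue_on ?I)" .
qed

text \<open>
  Both energies are compared with the integral \<open>A\<close> of \<open>g\<close> over the set where \<open>\<phi>\<close> does not vanish.
  The term that is linear in the derivative of \<open>\<phi>\<close> integrates to \<open>0\<close> over this set.
\<close>

lemma quasiminimizer_if_slopes_between:
  assumes p: "1 < p" and I: "\<alpha> < \<beta>"
    and u: "has_weak_deriv {\<alpha><..<\<beta>} u g" "in_Lp p {\<alpha><..<\<beta>} u"
    and g[measurable]: "g \<in> borel_measurable (lebesgue_on {\<alpha><..<\<beta>})"
    and d: "0 < d" and bounds: "\<And>x. \<alpha> < x \<Longrightarrow> x < \<beta> \<Longrightarrow> d \<le> g x \<and> g x \<le> s"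
  shows "quasiminimizer p ((s / d) powr (p - 1)) {\<alpha><..<\<beta>} u"
  unfolding quasiminimizer_def
proof (intro conjI ballI)
  let ?I = "{\<alpha><..<\<beta>}" and ?M = "lebesgue_on {\<alpha><..<\<beta>}"
  have "d \<le> s" using bounds[of "(\<alpha> + \<beta>) / 2"] I by (auto simp: field_simps)
  then have s: "0 < s" using d by simp
  have gL: "in_Lp p ?I g"
    by (rule in_Lp_bounded[OF _ g, of _ s]) (use p d bounds in fastforce)+
  show "u \<in> W1p_loc p ?I"
    unfolding W1p_loc_def using u gL by (auto intro!: in_Lp_imp_in_Lp_loc)
  fix \<phi> assume \<phi>: "\<phi> \<in> W1p_0 p ?I"
  from W1p_0_weak_derivE[OF p I \<phi>] obtain v where v: "has_weak_deriv ?I \<phi> v" "in_Lp p ?I \<phi>" "in_Lp p ?I v"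
    and v0: "(\<integral>x. indicator {x. \<phi> x \<noteq> 0} x * v x \<partial>?M) = 0"
    by blast
  let ?G = "indicator {x. \<phi> x \<noteq> 0} :: real \<Rightarrow> real"
  have [measurable]: "\<phi> \<in> borel_measurable ?M" "v \<in> borel_measurable ?M" using v by (auto simp: in_Lp_def)
  have gvL: "in_Lp p ?I (\<lambda>x. g x + v x)" using in_Lp_add[OF _ gL v(3)] p by simp
  interpret M: finite_measure ?M by (rule finite_measure_lebesgue_on_Ioo)
  have Gi: "integrable ?M (\<lambda>x. ?G x * w x)" if w: "integrable ?M w" for w :: "real \<Rightarrow> real"
  proof (rule Bochner_Integration.integrable_bound[OF w])
    note [measurable] = borel_measurable_integrable[OF w]
    show "(\<lambda>x. ?G x * w x) \<in> borel_measurable ?M" by measurable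
  qed (auto simp: indicator_def)
  have gi: "integrable ?M g" and vi: "integrable ?M v" using in_Lp_integrable[of p] gL v(3) p by auto
  note E = energy_eq_integral[OF u(1) gL \<open>\<phi> \<in> borel_measurable ?M\<close>]
  note E' = energy_eq_integral[OF has_weak_deriv_add[OF u(1) v(1)] gvL \<open>\<phi> \<in> borel_measurable ?M\<close>]
  define A where "A = (\<integral>x. ?G x * g x \<partial>?M)"
  have upper: "(\<integral>x. ?G x * \<bar>g x\<bar> powr p \<partial>?M) \<le> s powr (p - 1) * A"
  proof -
    have "(\<integral>x. ?G x * \<bar>g x\<bar> powr p \<partial>?M) \<le> (\<integral>x. s powr (p - 1) * (?G x * g x) \<partial>?M)"
    proof (rule integral_mono)
      fix x assume "x \<in> space ?M"
      then have x: "d \<le> g x" "g x \<le> s" using bounds[of x] by (auto simp: space_restrict_space)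
      have "\<bar>g x\<bar> powr p = g x powr (p - 1) * g x" using x d by (simp add: powr_diff)
      also have "\<dots> \<le> s powr (p - 1) * g x" using x d p by (intro mult_right_mono powr_mono2) auto
      finally show "?G x * \<bar>g x\<bar> powr p \<le> s powr (p - 1) * (?G x * g x)"
        by (auto simp: indicator_def)
    qed (use E(2) Gi[OF gi] in auto)
    then show ?thesis by (simp add: A_def)
  qed
  have lower: "d powr (p - 1) * A \<le> (\<integral>x. ?G x * \<bar>g x + v x\<bar> powr p \<partial>?M)"
  proof -
    have "d powr (p - 1) * A = (\<integral>x. d powr (p - 1) * (?G x * g x) + p * d powr (p - 1) * (?G x * v x) \<partial>?M)"
      using v0 Gi[OF gi] Gi[OF vi] by (simp add: A_def)
    also have "\<dots> \<le> (\<integral>x. ?G x * \<bar>g x + v x\<bar> powr p \<partial>?M)"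
    proof (rule integral_mono)
      fix x assume "x \<in> space ?M"
      then have x: "d \<le> g x" using bounds[of x] by (auto simp: space_restrict_space)
      have "p * d powr (p - 1) * (g x + v x) - (p - 1) * d powr p \<le> \<bar>g x + v x\<bar> powr p"
        by (rule powr_above_tangent[OF p d])
      moreover have "(p - 1) * d powr p \<le> (p - 1) * (d powr (p - 1) * g x)"
        using x d p by (intro mult_left_mono) (auto simp: powr_diff field_simps)
      ultimately have "d powr (p - 1) * g x + p * d powr (p - 1) * v x \<le> \<bar>g x + v x\<bar> powr p"
        by (simp add: algebra_simps)
      then show "d powr (p - 1) * (?G x * g x) + p * d powr (p - 1) * (?G x * v x) \<le> ?G x * \<bar>g x + v x\<bar> powr p"
        by (auto simp: indicator_def)
    qed (use E'(2) Gi[OF gi] Gi[OF vi] in auto)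
    finally show ?thesis .
  qed
  have "(\<integral>x. ?G x * \<bar>g x\<bar> powr p \<partial>?M) \<le> (s / d) powr (p - 1) * (d powr (p - 1) * A)"
    using upper s d by (simp add: powr_divide)
  also have "\<dots> \<le> (s / d) powr (p - 1) * (\<integral>x. ?G x * \<bar>g x + v x\<bar> powr p \<partial>?M)"
    by (rule mult_left_mono[OF lower]) simp
  finally show "energy p ?I \<phi> u \<le> ennreal ((s / d) powr (p - 1)) * energy p ?I \<phi> (\<lambda>x. u x + \<phi> x)"
    unfolding E(1) E'(1) by (simp flip: ennreal_mult'')
qed

lemma quasisuperminimizer_if_quasiminimizer:
  "quasiminimizer p Q \<Omega> u \<Longrightarrow> quasisuperminimizer p Q \<Omega> u"
  by (auto simp: quasiminimizer_def quasisuperminimizer_def)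

text \<open>
  The infimum of the admissible constants is admissible, since the defining inequality passes to the
  limit in the constant. An infinite energy on the right is harmless because the infimum is at least
  \<open>1\<close>.
\<close>

lemma optimal_quasisuperminimizer_constant_exists:
  assumes u: "quasisuperminimizer p Q0 \<Omega> u" "1 \<le> Q0"
    and lower: "\<And>Q. 1 \<le> Q \<Longrightarrow> quasisuperminimizer p Q \<Omega> u \<Longrightarrow> L \<le> Q"
  shows "\<exists>Q. optimal_quasisuperminimizer_constant p \<Omega> u Q \<and> L \<le> Q"
proof -
  let ?S = "{Q. 1 \<le> Q \<and> quasisuperminimizer p Q \<Omega> u}"
  define Q where "Q = Inf ?S"
  have ne: "?S \<noteq> {}" and bdd: "bdd_below ?S" using u by (auto intro: bdd_belowI[of _ 1])
  have "1 \<le> Q" "L \<le> Q" unfolding Q_def using ne lower by (auto intro!: cInf_greatest)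
  have least: "Q \<le> Q'" if "1 \<le> Q'" "quasisuperminimizer p Q' \<Omega> u" for Q'
    unfolding Q_def using that by (intro cInf_lower[OF _ bdd]) auto
  have "quasisuperminimizer p Q \<Omega> u"
    unfolding quasisuperminimizer_def
  proof (intro conjI ballI impI)
    show "u \<in> W1p_loc p \<Omega>" using u by (simp add: quasisuperminimizer_def)
    fix \<phi> assume \<phi>: "\<phi> \<in> W1p_0 p \<Omega>" "AE x in lebesgue_on \<Omega>. 0 \<le> \<phi> x"
    let ?E = "energy p \<Omega> \<phi> u" and ?F = "energy p \<Omega> \<phi> (\<lambda>x. u x + \<phi> x)"
    have *: "?E \<le> ennreal (Q + 1 / Suc n) * ?F" for n
    proof -
      have "Inf ?S < Q + 1 / Suc n" by (simp add: Q_def)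
      then obtain Q' where Q': "Q' \<in> ?S" "Q' < Q + 1 / Suc n" using cInf_lessD[OF ne] by blast
      then have "?E \<le> ennreal Q' * ?F" using \<phi> by (auto simp: quasisuperminimizer_def)
      also have "\<dots> \<le> ennreal (Q + 1 / Suc n) * ?F" using Q' by (intro mult_right_mono ennreal_leI) auto
      finally show ?thesis .
    qed
    show "?E \<le> ennreal Q * ?F"
    proof (cases "?F = \<infinity>")
      case True
      then show ?thesis using \<open>1 \<le> Q\<close> by (simp add: ennreal_mult_top)
    next
      case False
      have "(\<lambda>n. Q + 1 / Suc n) \<longlonglongrightarrow> Q" by real_asymp
      then have "(\<lambda>n. ennreal (Q + 1 / Suc n) * ?F) \<longlonglongrightarrow> ennreal Q * ?F"
        using False by (intro tendsto_mult_ennreal tendsto_ennrealI tendsto_const) (auto simp: top_unique)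
      then show ?thesis by (rule LIMSEQ_le_const) (use * in auto)
    qed
  qed
  then show ?thesis
    unfolding optimal_quasisuperminimizer_constant_def using \<open>1 \<le> Q\<close> \<open>L \<le> Q\<close> least by blast
qed

section \<open>A criterion for zero boundary values\<close>

lemma in_Lp_continuous:
  assumes "0 \<le> p" "continuous_on UNIV u"
  shows "in_Lp p {\<alpha><..<\<beta>} u"
proof -
  have "bounded (u ` {\<alpha>..\<beta>})"
    by (intro compact_imp_bounded compact_continuous_image continuous_on_subset[OF assms(2)]) auto
  then obtain B where "\<forall>x\<in>{\<alpha>..\<beta>}. \<bar>u x\<bar> \<le> B" unfolding bounded_iff by auto
  then show ?thesis
    using assms by (intro in_Lp_bounded[of _ _ _ _ B] continuous_imp_measurable_on_sets_lebesgue
      continuous_on_subset[OF assms(2)]) auto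
qed

lemma W1p_norm_tendsto_0:
  assumes p: "1 < p"
    and D: "\<And>n. has_weak_deriv {\<alpha><..<\<beta>} (f n) (f' n)"
    and m: "\<And>n. f n \<in> borel_measurable (lebesgue_on {\<alpha><..<\<beta>})"
      "\<And>n. f' n \<in> borel_measurable (lebesgue_on {\<alpha><..<\<beta>})"
    and B: "\<And>n x. x \<in> {\<alpha><..<\<beta>} \<Longrightarrow> \<bar>f n x\<bar> \<le> B" "\<And>n x. x \<in> {\<alpha><..<\<beta>} \<Longrightarrow> \<bar>f' n x\<bar> \<le> B"
    and lim: "\<And>x. x \<in> {\<alpha><..<\<beta>} \<Longrightarrow> (\<lambda>n. f n x) \<longlonglongrightarrow> 0" "\<And>x. x \<in> {\<alpha><..<\<beta>} \<Longrightarrow> (\<lambda>n. f' n x) \<longlonglongrightarrow> 0"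
  shows "(\<lambda>n. W1p_norm p {\<alpha><..<\<beta>} (f n)) \<longlonglongrightarrow> 0"
proof -
  let ?M = "lebesgue_on {\<alpha><..<\<beta>}"
  interpret M: finite_measure ?M by (rule finite_measure_lebesgue_on_Ioo)
  note [measurable] = m borel_measurable_weak_deriv[OF D m(2)]
  have space: "space ?M = {\<alpha><..<\<beta>}" by (simp add: space_restrict_space)
  have eq: "W1p_norm p {\<alpha><..<\<beta>} (f n) = (\<integral>x. \<bar>f n x\<bar> powr p + \<bar>f' n x\<bar> powr p \<partial>?M) powr (1 / p)" for n
  proof -
    have "(\<integral>x. \<bar>f n x\<bar> powr p + \<bar>weak_deriv {\<alpha><..<\<beta>} (f n) x\<bar> powr p \<partial>?M) =
        (\<integral>x. \<bar>f n x\<bar> powr p + \<bar>f' n x\<bar> powr p \<partial>?M)"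
    proof (rule integral_cong_AE)
      show "AE x in ?M. \<bar>f n x\<bar> powr p + \<bar>weak_deriv {\<alpha><..<\<beta>} (f n) x\<bar> powr p = \<bar>f n x\<bar> powr p + \<bar>f' n x\<bar> powr p"
        using weak_deriv_AE_eq[OF D[of n]] by eventually_elim simp
    qed measurable
    then show ?thesis by (simp add: W1p_norm_def)
  qed
  have "(\<lambda>n. \<integral>x. \<bar>f n x\<bar> powr p + \<bar>f' n x\<bar> powr p \<partial>?M) \<longlonglongrightarrow> (\<integral>x. 0 \<partial>?M)"
  proof (rule integral_dominated_convergence)
    show "integrable ?M (\<lambda>x. 2 * \<bar>B\<bar> powr p)" by simp
    have z: "(\<lambda>n. \<bar>w n\<bar> powr p) \<longlonglongrightarrow> 0" if "w \<longlonglongrightarrow> 0" for w :: "nat \<Rightarrow> real"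
    proof -
      have "(\<lambda>n. \<bar>w n\<bar> powr p) \<longlonglongrightarrow> \<bar>0\<bar> powr p"
        using that p by (intro tendsto_powr' tendsto_rabs tendsto_const) auto
      then show ?thesis using p by simp
    qed
    have "(\<lambda>n. \<bar>f n x\<bar> powr p + \<bar>f' n x\<bar> powr p) \<longlonglongrightarrow> 0" if "x \<in> {\<alpha><..<\<beta>}" for x
      using tendsto_add[OF z[OF lim(1)[OF that]] z[OF lim(2)[OF that]]] by simp
    then show "AE x in ?M. (\<lambda>n. \<bar>f n x\<bar> powr p + \<bar>f' n x\<bar> powr p) \<longlonglongrightarrow> 0"
      using space by (intro AE_I2) blast
    have "\<bar>f n x\<bar> powr p \<le> \<bar>B\<bar> powr p" "\<bar>f' n x\<bar> powr p \<le> \<bar>B\<bar> powr p" if "x \<in> {\<alpha><..<\<beta>}" for n x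
      using B(1)[OF that, of n] B(2)[OF that, of n] p by (auto intro!: powr_mono2)
    then have "norm (\<bar>f n x\<bar> powr p + \<bar>f' n x\<bar> powr p) \<le> 2 * \<bar>B\<bar> powr p" if "x \<in> {\<alpha><..<\<beta>}" for n x
      using add_mono[of "\<bar>f n x\<bar> powr p" _ "\<bar>f' n x\<bar> powr p"] that by fastforce
    then show "AE x in ?M. norm (\<bar>f n x\<bar> powr p + \<bar>f' n x\<bar> powr p) \<le> 2 * \<bar>B\<bar> powr p" for n
      using space by (intro AE_I2) blast
  qed measurable
  then have "(\<lambda>n. (\<integral>x. \<bar>f n x\<bar> powr p + \<bar>f' n x\<bar> powr p \<partial>?M) powr (1 / p)) \<longlonglongrightarrow> 0 powr (1 / p)"
    using p by (intro tendsto_powr' tendsto_const) (auto intro!: always_eventually integral_nonneg_AE)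
  then show ?thesis using p by (simp add: eq)
qed

text \<open>
  The approximating test functions are the antiderivatives of the \<open>\<gamma> n\<close>, corrected by a small multiple
  of a fixed bump so that the integral vanishes and the antiderivative has compact support. The
  correction tends to \<open>0\<close> because \<open>g\<close> has integral \<open>\<phi> \<beta> - \<phi> \<alpha> = 0\<close>.
\<close>

lemma W1p_0_if_piecewise_derivative_limit:
  assumes p: "1 < p" and I: "\<alpha> < \<beta>" and "finite S" and cont: "continuous_on UNIV \<phi>"
    and der: "\<And>x. x \<notin> S \<Longrightarrow> (\<phi> has_real_derivative g x) (at x)"
    and bd: "\<phi> \<alpha> = 0" "\<phi> \<beta> = 0"
    and \<gamma>: "\<And>n::nat. test_function {\<alpha><..<\<beta>} (\<gamma> n)" "\<And>n x. \<bar>\<gamma> n x\<bar> \<le> B"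
    and lim: "\<And>x. (\<lambda>n. \<gamma> n x) \<longlonglongrightarrow> g x"
  shows "\<phi> \<in> W1p_0 p {\<alpha><..<\<beta>}"
proof -
  let ?I = "{\<alpha><..<\<beta>}" and ?K = "lebesgue_on {\<alpha>..\<beta>}"
  have fin: "finite_measure ?K" by (rule finite_measure_lebesgue_on[OF lmeasurable_compact[OF compact_Icc]])
  have measure: "measure ?K (space ?K) = \<beta> - \<alpha>" using I by (simp add: measure_restrict_space space_restrict_space)
  have B0: "0 \<le> B" using \<gamma>(2)[of 0 0] by linarith
  have \<gamma>m[measurable]: "\<gamma> n \<in> borel_measurable lebesgue" for n
    by (rule smooth_measurable[OF test_function_smooth[OF \<gamma>(1)]])
  have gm[measurable]: "g \<in> borel_measurable lebesgue"
    by (rule borel_measurable_LIMSEQ_real[OF lim \<gamma>m])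
  have gB: "\<bar>g x\<bar> \<le> B" for x
  proof (rule LIMSEQ_le_const2)
    show "(\<lambda>n. \<bar>\<gamma> n x\<bar>) \<longlonglongrightarrow> \<bar>g x\<bar>" by (intro tendsto_rabs lim)
  qed (use \<gamma>(2) in auto)
  have Ki: "integrable (lebesgue_on {a..b}) f" if "f \<in> borel_measurable lebesgue" "\<And>x. \<bar>f x\<bar> \<le> C" for f :: "real \<Rightarrow> real" and C a b
  proof (rule finite_measure.integrable_const_bound)
    show "finite_measure (lebesgue_on {a..b})"
      by (rule finite_measure_lebesgue_on[OF lmeasurable_compact[OF compact_Icc]])
    show "f \<in> borel_measurable (lebesgue_on {a..b})" by (rule measurable_restrict_space1[OF that(1)])
    show "AE x in lebesgue_on {a..b}. norm (f x) \<le> C" using that(2) by simp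
  qed
  have dct: "(\<lambda>n. \<integral>x. f n x \<partial>?K) \<longlonglongrightarrow> (\<integral>x. f0 x \<partial>?K)"
    if m: "\<And>n. f n \<in> borel_measurable lebesgue" and l: "\<And>x. (\<lambda>n. f n x) \<longlonglongrightarrow> f0 x" and b: "\<And>n x. \<bar>f n x\<bar> \<le> C"
    for f :: "nat \<Rightarrow> real \<Rightarrow> real" and f0 C
  proof (rule integral_dominated_convergence)
    show "integrable ?K (\<lambda>x. C)" using fin by (rule finite_measure.integrable_const)
    show "f n \<in> borel_measurable ?K" for n by (rule measurable_restrict_space1[OF m])
    show "f0 \<in> borel_measurable ?K" by (rule measurable_restrict_space1[OF borel_measurable_LIMSEQ_real[OF l m]])
    show "AE x in ?K. (\<lambda>n. f n x) \<longlonglongrightarrow> f0 x" using l by simp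
    show "AE x in ?K. norm (f n x) \<le> C" for n using b by simp
  qed
  have bump_meas: "bump \<alpha> \<beta> n \<in> borel_measurable lebesgue" for n by (rule smooth_measurable[OF smooth_bump])
  have "(\<lambda>n. \<integral>x. bump \<alpha> \<beta> n x \<partial>?K) \<longlonglongrightarrow> (\<integral>x. indicator ?I x \<partial>?K)"
    by (rule dct[where C=1, OF bump_meas bump_tendsto bump_abs_le])
  also have "(\<integral>x. indicat_real ?I x \<partial>?K) = (\<integral>x. indicator {\<alpha>..\<beta>} x *\<^sub>R indicat_real ?I x \<partial>lebesgue)"
    by (subst integral_restrict_space) simp_all
  also have "(\<lambda>x. indicator {\<alpha>..\<beta>} x *\<^sub>R indicat_real ?I x) = (indicator ?I :: real \<Rightarrow> real)"
    by (auto simp: fun_eq_iff indicator_def)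
  also have "(\<integral>x. indicat_real ?I x \<partial>lebesgue) = \<beta> - \<alpha>" using I by simp
  finally have "eventually (\<lambda>n. 0 < (\<integral>x. bump \<alpha> \<beta> n x \<partial>?K)) sequentially"
    by (rule order_tendstoD) (use I in simp)
  then have "eventually (\<lambda>n. 0 < (\<integral>x. bump \<alpha> \<beta> n x \<partial>?K) \<and> 0 < n) sequentially"
    using eventually_gt_at_top[of 0] by eventually_elim simp
  then obtain N where N: "0 < (\<integral>x. bump \<alpha> \<beta> N x \<partial>?K)" "0 < N"
    by (auto dest: eventually_happens'[OF sequentially_bot])
  \<comment> \<open>The bump used for the correction, normalized by its integral \<open>J\<close>.\<close>
  define J where "J = (\<integral>x. bump \<alpha> \<beta> N x \<partial>?K)"
  define c where "c n = (\<integral>x. \<gamma> n x \<partial>?K) / J" for n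
  define \<eta> where "\<eta> n x = \<gamma> n x + (- c n) * bump \<alpha> \<beta> N x" for n x
  have \<eta>t: "test_function ?I (\<eta> n)" for n
    unfolding \<eta>_def using N(2)
    by (intro test_function_add \<gamma> test_function_mult_left test_function_bump smooth_const) auto
  note \<eta>s = test_function_smooth[OF \<eta>t]
  have \<eta>m[measurable]: "\<eta> n \<in> borel_measurable lebesgue" for n by (rule smooth_measurable[OF \<eta>s])
  have "(\<lambda>n. \<integral>x. \<gamma> n x \<partial>?K) \<longlonglongrightarrow> (\<integral>x. g x \<partial>?K)"
    by (rule dct[where C=B, OF \<gamma>m lim \<gamma>(2)])
  also have "(\<integral>x. g x \<partial>?K) = integral {\<alpha>..\<beta>} g"
    by (rule lebesgue_integral_eq_integral[OF Ki[OF gm gB]]) simp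
  also have "integral {\<alpha>..\<beta>} g = \<phi> \<beta> - \<phi> \<alpha>"
    by (rule integral_unique, rule fundamental_theorem_of_calculus_strong[OF \<open>finite S\<close>])
      (use I der continuous_on_subset[OF cont] in \<open>auto simp flip: has_real_derivative_iff_has_vector_derivative\<close>)
  finally have "(\<lambda>n. (\<integral>x. \<gamma> n x \<partial>?K) / J) \<longlonglongrightarrow> 0 / J"
    using N(1) bd by (intro tendsto_divide tendsto_const) (auto simp: J_def)
  then have c0: "c \<longlonglongrightarrow> 0" by (simp add: c_def[abs_def])
  then obtain C where C: "\<And>n. \<bar>c n\<bar> \<le> C"
    using convergent_imp_Bseq[of c] by (auto simp: convergent_def Bseq_def)
  have \<eta>B: "\<bar>\<eta> n x\<bar> \<le> B + C" for n x
  proof -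
    have "\<bar>\<eta> n x\<bar> \<le> \<bar>\<gamma> n x\<bar> + \<bar>c n\<bar> * \<bar>bump \<alpha> \<beta> N x\<bar>"
      unfolding \<eta>_def using abs_triangle_ineq[of "\<gamma> n x" "- c n * bump \<alpha> \<beta> N x"] by (simp add: abs_mult)
    also have "\<dots> \<le> B + C * 1"
      using C[of n] \<gamma>(2)[of n x] bump_abs_le[of \<alpha> \<beta> N x] by (intro add_mono mult_mono) auto
    finally show ?thesis by simp
  qed
  have \<eta>lim: "(\<lambda>n. \<eta> n x) \<longlonglongrightarrow> g x" for x
  proof -
    have "(\<lambda>n. \<eta> n x) \<longlonglongrightarrow> g x + (- 0) * bump \<alpha> \<beta> N x"
      unfolding \<eta>_def by (intro tendsto_intros lim c0)
    then show ?thesis by simp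
  qed
  have \<eta>0: "integral {\<alpha>..\<beta>} (\<eta> n) = 0" for n
  proof -
    have "integral {\<alpha>..\<beta>} (\<eta> n) = (\<integral>x. \<eta> n x \<partial>?K)"
      by (rule lebesgue_integral_eq_integral[symmetric, OF Ki[OF \<eta>m \<eta>B]]) simp
    also have "\<dots> = (\<integral>x. \<gamma> n x \<partial>?K) + (\<integral>x. (- c n) * bump \<alpha> \<beta> N x \<partial>?K)"
      unfolding \<eta>_def
      by (intro Bochner_Integration.integral_add integrable_mult_right Ki[OF \<gamma>m \<gamma>(2)] Ki[OF bump_meas bump_abs_le])
    also have "\<dots> = 0" using N(1) by (simp add: c_def J_def)
    finally show ?thesis .
  qed
  have "\<forall>n. \<exists>H. H \<alpha> = 0 \<and> (\<forall>x. (H has_real_derivative \<eta> n x) (at x))"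
  proof
    fix n
    obtain H where H: "\<And>x. (H has_real_derivative \<eta> n x) (at x)"
      by (rule continuous_antiderivative[OF smooth_continuous[OF \<eta>s]]) blast
    show "\<exists>H. H \<alpha> = 0 \<and> (\<forall>x. (H has_real_derivative \<eta> n x) (at x))"
      by (rule exI[of _ "\<lambda>x. H x - H \<alpha>"]) (auto intro!: derivative_eq_intros H)
  qed
  then obtain \<psi> where \<psi>0: "\<And>n. \<psi> n \<alpha> = 0" and \<psi>D: "\<And>n x. (\<psi> n has_real_derivative \<eta> n x) (at x)"
    by metis
  have \<psi>s: "smooth (\<psi> n)" for n by (rule smooth_antideriv[OF \<eta>s \<psi>D])
  have FTC: "(\<eta> n has_integral \<psi> n y - \<psi> n x) {x..y}" if "x \<le> y" for n x y
    by (rule fundamental_theorem_of_calculus[OF that])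
      (auto simp flip: has_real_derivative_iff_has_vector_derivative intro: has_field_derivative_at_within \<psi>D)
  have \<psi>t: "test_function ?I (\<psi> n)" for n
  proof -
    obtain a b where ab: "\<alpha> < a" "a \<le> b" "b < \<beta>" "\<And>x. x < a \<or> b < x \<Longrightarrow> \<eta> n x = 0"
      using test_function_supportE[OF \<eta>t I] by metis
    have const: "\<psi> n x = \<psi> n y" if "x \<le> y" "\<And>t. x \<le> t \<Longrightarrow> t \<le> y \<Longrightarrow> \<eta> n t = 0" for x y
      using has_integral_unique[OF FTC[OF that(1)] has_integral_is_0[of "{x..y}" "\<eta> n"]] that(2) by auto
    have \<psi>1: "\<psi> n \<beta> = 0" using FTC[of \<alpha> \<beta> n] \<eta>0[of n] I \<psi>0 by (auto dest: integral_unique)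
    have "a \<le> x \<and> x \<le> b" if "\<psi> n x \<noteq> 0" for x
    proof (rule ccontr)
      assume "\<not> (a \<le> x \<and> x \<le> b)"
      then consider "x < a" | "b < x" by linarith
      then have "\<psi> n x = 0"
      proof cases
        case 1
        have "\<psi> n (min x \<alpha>) = \<psi> n (max x \<alpha>)" using 1 ab(1) by (intro const ab(4)) (auto simp: max_def split: if_splits)
        then show ?thesis using \<psi>0[of n] by (cases "x \<le> \<alpha>") (auto simp: min_def max_def)
      next
        case 2
        have "\<psi> n (min x \<beta>) = \<psi> n (max x \<beta>)" using 2 ab(3) by (intro const ab(4)) (auto simp: min_def split: if_splits)
        then show ?thesis using \<psi>1 by (cases "x \<le> \<beta>") (auto simp: min_def max_def)
      qed
      with that show False by simp
    qed
    then show ?thesis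
      unfolding test_function_Ioo_iff using \<psi>s[of n] ab by blast
  qed
  \<comment> \<open>The \<open>L\<^sup>1\<close> distance of the derivatives bounds the distance of the functions uniformly.\<close>
  define e where "e n = (\<integral>x. \<bar>g x - \<eta> n x\<bar> \<partial>?K)" for n
  have diffB: "\<bar>g x - \<eta> n x\<bar> \<le> 2 * B + C" for n x
    using gB[of x] \<eta>B[of n x] by linarith
  have "e \<longlonglongrightarrow> (\<integral>x. 0 \<partial>?K)"
    unfolding e_def
  proof (rule dct)
    show "(\<lambda>x. \<bar>g x - \<eta> n x\<bar>) \<in> borel_measurable lebesgue" for n by measurable
    show "(\<lambda>n. \<bar>g x - \<eta> n x\<bar>) \<longlonglongrightarrow> 0" for x
      using tendsto_rabs[OF tendsto_diff[OF tendsto_const \<eta>lim[of x], of "g x"]] by simp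
    show "\<bar>\<bar>g x - \<eta> n x\<bar>\<bar> \<le> 2 * B + C" for n x using diffB by simp
  qed
  then have e0: "e \<longlonglongrightarrow> 0" by simp
  have uniform: "\<bar>\<phi> x - \<psi> n x\<bar> \<le> e n" if x: "x \<in> ?I" for n x
  proof -
    have m: "(\<lambda>x. g x - \<eta> n x) \<in> borel_measurable lebesgue" by measurable
    have "((\<lambda>x. g x - \<eta> n x) has_integral (\<phi> x - \<psi> n x) - (\<phi> \<alpha> - \<psi> n \<alpha>)) {\<alpha>..x}"
    proof (rule fundamental_theorem_of_calculus_strong[OF \<open>finite S\<close>])
      show "continuous_on {\<alpha>..x} (\<lambda>x. \<phi> x - \<psi> n x)"
        by (intro continuous_on_diff continuous_on_subset[OF cont] smooth_continuous \<psi>s) auto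
      show "((\<lambda>x. \<phi> x - \<psi> n x) has_vector_derivative g y - \<eta> n y) (at y)" if "y \<in> {\<alpha>..x} - S" for y
        using DERIV_diff[OF der[of y] \<psi>D[of n y]] that
        unfolding has_real_derivative_iff_has_vector_derivative by blast
    qed (use x in auto)
    then have "\<phi> x - \<psi> n x = integral {\<alpha>..x} (\<lambda>x. g x - \<eta> n x)"
      using integral_unique[of "\<lambda>x. g x - \<eta> n x"] bd(1) \<psi>0[of n] by simp
    also have "\<dots> = (\<integral>x. g x - \<eta> n x \<partial>lebesgue_on {\<alpha>..x})"
      by (rule lebesgue_integral_eq_integral[symmetric, OF Ki[OF m diffB]]) simp
    also have "\<dots> = (\<integral>y. indicator {\<alpha>..x} y *\<^sub>R (g y - \<eta> n y) \<partial>lebesgue)"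
      by (rule integral_restrict_space) simp
    also have "\<bar>\<dots>\<bar> \<le> (\<integral>y. norm (indicator {\<alpha>..x} y *\<^sub>R (g y - \<eta> n y)) \<partial>lebesgue)"
      using integral_norm_bound[of lebesgue "\<lambda>y. indicator {\<alpha>..x} y *\<^sub>R (g y - \<eta> n y)"] by (simp only: real_norm_def)
    also have "\<dots> \<le> (\<integral>y. indicator {\<alpha>..\<beta>} y *\<^sub>R \<bar>g y - \<eta> n y\<bar> \<partial>lebesgue)"
    proof (rule integral_mono)
      show "integrable lebesgue (\<lambda>y. norm (indicator {\<alpha>..x} y *\<^sub>R (g y - \<eta> n y)))"
        by (rule integrable_norm, rule integrable_restrict_space[THEN iffD1, OF _ Ki[OF m diffB]]) simp
      show "integrable lebesgue (\<lambda>y. indicator {\<alpha>..\<beta>} y *\<^sub>R \<bar>g y - \<eta> n y\<bar>)"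
        by (rule integrable_restrict_space[THEN iffD1, OF _ integrable_abs[OF Ki[OF m diffB]]]) simp
    qed (use x in \<open>auto simp: indicator_def\<close>)
    also have "\<dots> = e n" unfolding e_def by (rule integral_restrict_space[symmetric]) simp
    finally show ?thesis .
  qed
  obtain E where E: "\<And>n. \<bar>e n\<bar> \<le> E"
    using convergent_imp_Bseq[of e] e0 by (auto simp: convergent_def Bseq_def)
  have \<psi>_deriv: "deriv (\<psi> n) = \<eta> n" for n using \<psi>D by (auto intro: DERIV_imp_deriv)
  have D\<phi>: "has_weak_deriv ?I \<phi> g" by (rule has_weak_deriv_piecewise[OF \<open>finite S\<close> cont der gm gB])
  have D: "has_weak_deriv ?I (\<lambda>x. \<phi> x - \<psi> n x) (\<lambda>x. g x - \<eta> n x)" for n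
    using has_weak_deriv_add[OF D\<phi> has_weak_deriv_uminus[OF has_weak_deriv_test_function[OF \<psi>t[of n]]]]
    by (simp add: \<psi>_deriv)
  have \<phi>m: "\<phi> \<in> borel_measurable (lebesgue_on ?I)"
    by (intro continuous_imp_measurable_on_sets_lebesgue continuous_on_subset[OF cont]) auto
  have lim0: "(\<lambda>n. W1p_norm p ?I (\<lambda>x. \<phi> x - \<psi> n x)) \<longlonglongrightarrow> 0"
  proof (rule W1p_norm_tendsto_0[OF p D, where B = "max E (2 * B + C)"])
    show "(\<lambda>x. \<phi> x - \<psi> n x) \<in> borel_measurable (lebesgue_on ?I)" for n
      by (intro borel_measurable_diff \<phi>m measurable_restrict_space1 smooth_measurable \<psi>s)
    show "(\<lambda>x. g x - \<eta> n x) \<in> borel_measurable (lebesgue_on ?I)" for n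
      by (intro borel_measurable_diff measurable_restrict_space1 gm \<eta>m)
    show "\<bar>\<phi> x - \<psi> n x\<bar> \<le> max E (2 * B + C)" if "x \<in> ?I" for n x
      using uniform[OF that, of n] E[of n] by linarith
    show "\<bar>g x - \<eta> n x\<bar> \<le> max E (2 * B + C)" for n x using diffB[of x n] by linarith
    show "(\<lambda>n. \<phi> x - \<psi> n x) \<longlonglongrightarrow> 0" if "x \<in> ?I" for x
      by (rule Lim_null_comparison[OF _ e0]) (use uniform[OF that] in simp)
    show "(\<lambda>n. g x - \<eta> n x) \<longlonglongrightarrow> 0" for x
      using tendsto_diff[OF tendsto_const \<eta>lim[of x], of "g x"] by simp
  qed
  show ?thesis
    unfolding W1p_0_def
  proof (intro CollectI conjI allI impI)
    have "in_Lp p ?I \<phi>" using p by (intro in_Lp_continuous cont) auto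
    moreover have "in_Lp p ?I g"
      using p gB by (intro in_Lp_bounded[of _ _ _ _ B] measurable_restrict_space1 gm) auto
    ultimately show "\<phi> \<in> W1p p ?I" using D\<phi> unfolding W1p_def by blast
    fix \<epsilon> :: real assume "0 < \<epsilon>"
    from order_tendstoD(2)[OF lim0 this] obtain n where "W1p_norm p ?I (\<lambda>x. \<phi> x - \<psi> n x) < \<epsilon>"
      by (auto dest: eventually_happens'[OF sequentially_bot])
    then show "\<exists>\<psi>. test_function ?I \<psi> \<and> W1p_norm p ?I (\<lambda>x. \<phi> x - \<psi> x) < \<epsilon>" using \<psi>t[of n] by blast
  qed
qed

section \<open>Tents and the energy of two slopes\<close>

text \<open>
  When the two lines meet at \<open>c\<close>, that is \<open>k * (c - a) = l * (b - c)\<close>, this is the tent with base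
  \<open>[a, b]\<close> and apex over \<open>c\<close>. The formula with \<open>max\<close> and \<open>min\<close> makes it continuous and \<open>0\<close> outside the
  base without case distinctions.
\<close>

definition tent :: "real \<Rightarrow> real \<Rightarrow> real \<Rightarrow> real \<Rightarrow> real \<Rightarrow> real \<Rightarrow> real" where
  "tent a c b k l x = max 0 (min (k * (x - a)) (l * (b - x)))"

definition tent_slope :: "real \<Rightarrow> real \<Rightarrow> real \<Rightarrow> real \<Rightarrow> real \<Rightarrow> real \<Rightarrow> real" where
  "tent_slope a c b k l x = k * indicator {a<..<c} x - l * indicator {c<..<b} x"

lemma tent_nonneg: "0 \<le> tent a c b k l x"
  by (simp add: tent_def)

lemma continuous_on_tent: "continuous_on A (tent a c b k l)"
  unfolding tent_def[abs_def] by (intro continuous_intros)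

lemma tent_outside:
  assumes "0 \<le> k" "0 \<le> l" "x \<le> a \<or> b \<le> x" shows "tent a c b k l x = 0"
proof -
  have "k * (x - a) \<le> 0 \<or> l * (b - x) \<le> 0"
    using assms mult_nonneg_nonpos[of k "x - a"] mult_nonneg_nonpos[of l "b - x"] by linarith
  then show ?thesis by (simp add: tent_def max_absorb1 min_le_iff_disj)
qed

lemma tent_left:
  assumes "0 \<le> k" "0 \<le> l" "k * (c - a) = l * (b - c)" "a \<le> x" "x \<le> c"
  shows "tent a c b k l x = k * (x - a)"
proof -
  have "k * (x - a) \<le> k * (c - a)" "l * (b - c) \<le> l * (b - x)"
    by (rule mult_left_mono; use assms in linarith)+
  moreover have "0 \<le> k * (x - a)" using assms by simp
  ultimately show ?thesis using assms(3) by (simp add: tent_def)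
qed

lemma tent_right:
  assumes "0 \<le> k" "0 \<le> l" "k * (c - a) = l * (b - c)" "c \<le> x" "x \<le> b"
  shows "tent a c b k l x = l * (b - x)"
proof -
  have "k * (c - a) \<le> k * (x - a)" "l * (b - x) \<le> l * (b - c)"
    by (rule mult_left_mono; use assms in linarith)+
  moreover have "0 \<le> l * (b - x)" using assms by simp
  ultimately show ?thesis using assms(3) by (simp add: tent_def)
qed

lemma has_real_derivative_tent:
  assumes kl: "0 \<le> k" "0 \<le> l" "k * (c - a) = l * (b - c)" and "a < c" "c < b" and x: "x \<notin> {a, c, b}"
  shows "(tent a c b k l has_real_derivative tent_slope a c b k l x) (at x)"
proof -
  have *: "(tent a c b k l has_real_derivative D) (at x)"
    if "(f has_real_derivative D) (at x)" "open U" "x \<in> U" "\<And>y. y \<in> U \<Longrightarrow> tent a c b k l y = f y" for f D U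
    using that by (auto intro: has_field_derivative_transform_within_open[of f D x U])
  consider "x < a" | "a < x" "x < c" | "c < x" "x < b" | "b < x" using x by fastforce
  then show ?thesis
  proof cases
    case 1
    show ?thesis
      by (rule *[of "\<lambda>x. 0" _ "{..<a}"]) (use 1 kl \<open>a < c\<close> in \<open>auto simp: tent_slope_def tent_outside\<close>)
  next
    case 2
    show ?thesis
      by (rule *[of "\<lambda>x. k * (x - a)" _ "{a<..<c}"])
        (use 2 in \<open>auto simp: tent_slope_def tent_left[OF kl] intro!: derivative_eq_intros\<close>)
  next
    case 3
    show ?thesis
      by (rule *[of "\<lambda>x. l * (b - x)" _ "{c<..<b}"])
        (use 3 in \<open>auto simp: tent_slope_def tent_right[OF kl] intro!: derivative_eq_intros\<close>)
  next
    case 4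
    show ?thesis
      by (rule *[of "\<lambda>x. 0" _ "{b<..}"]) (use 4 kl \<open>c < b\<close> in \<open>auto simp: tent_slope_def tent_outside\<close>)
  qed
qed

lemma tent_slope_measurable [measurable]: "tent_slope a c b k l \<in> borel_measurable lebesgue"
  unfolding tent_slope_def[abs_def]
  by (intro borel_measurable_diff borel_measurable_times borel_measurable_const borel_measurable_indicator) auto

lemma tent_slope_bound: "\<bar>tent_slope a c b k l x\<bar> \<le> \<bar>k\<bar> + \<bar>l\<bar>"
  by (auto simp: tent_slope_def indicator_def)

lemma tent_slope_approx:
  "(\<lambda>n. k * bump a c (Suc n) x + (- l) * bump c b (Suc n) x) \<longlonglongrightarrow> tent_slope a c b k l x"
proof -
  have "(\<lambda>n. k * bump a c (Suc n) x + (- l) * bump c b (Suc n) x) \<longlonglongrightarrow>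
      k * indicator {a<..<c} x + (- l) * indicator {c<..<b} x"
    by (intro tendsto_add tendsto_mult tendsto_const LIMSEQ_Suc bump_tendsto)
  then show ?thesis by (simp add: tent_slope_def)
qed

lemma tent_slope_approx_bound:
  "\<bar>k * bump a c n x + (- l) * bump c b n x\<bar> \<le> \<bar>k\<bar> + \<bar>l\<bar>"
proof -
  have "\<bar>k * bump a c n x\<bar> \<le> \<bar>k\<bar>" "\<bar>(- l) * bump c b n x\<bar> \<le> \<bar>l\<bar>"
    using bump_bounds[of a c n x] bump_bounds[of c b n x] by (auto simp: abs_mult intro!: mult_left_le)
  then show ?thesis by linarith
qed

text \<open>
  The number \<open>1 - r + r * q\<close> is the average of slope \<open>1\<close> on a part of length \<open>1 - r\<close> and slope \<open>q\<close> on
  a part of length \<open>r\<close>. The choice of \<open>r\<close> makes the increment over the steep part \<open>K\<close> times the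
  increment over the flat part, so the average is \<open>(1 - r) * (1 + K)\<close>.
\<close>

lemma energy_of_steep_part:
  fixes K p q :: real
  assumes "0 < K" "1 \<le> p" "1 \<le> q"
  defines "r \<equiv> K / (K + q)"
  shows "K / (1 + K) powr p * q powr (p - 1) * (1 - r + r * q) powr p \<le> r * q powr p"
proof -
  have pos: "0 < K + q" using assms by linarith
  have r1: "1 - r = q / (K + q)" using pos by (simp add: r_def field_simps)
  have a: "1 - r + r * q = (1 - r) * (1 + K)" 
  proof -
    have "r * q = K * (1 - r)" unfolding r1 by (simp add: r_def)
    then show ?thesis by (simp add: algebra_simps)
  qed
  have r01: "0 < 1 - r" "1 - r \<le> 1" unfolding r1 using assms pos by auto
  have "(1 - r) powr p \<le> 1 - r"
    using powr_mono'[of 1 p "1 - r"] r01 assms(2) by simp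
  have "K / (1 + K) powr p * q powr (p - 1) * (1 - r + r * q) powr p = K * q powr (p - 1) * (1 - r) powr p"
    unfolding a using assms(1) r01 by (simp add: powr_mult)
  also have "\<dots> \<le> K * q powr (p - 1) * (1 - r)"
    using \<open>(1 - r) powr p \<le> 1 - r\<close> assms by (intro mult_left_mono) auto
  also have "\<dots> = r * q powr p"
    unfolding r1 using assms pos by (simp add: r_def powr_diff)
  finally show ?thesis .
qed

text \<open>
  Here \<open>\<eta> = p - 1\<close> and \<open>K = 1 / \<eta>\<close>: the increment ratio \<open>K\<close> has to be large, while \<open>(1 + K) powr \<eta>\<close>
  still has to tend to \<open>1\<close>.
\<close>

lemma exists_exponent_near_1:
  fixes Q \<epsilon> :: real
  assumes "0 < \<epsilon>"
  obtains \<eta> where "0 < \<eta>" "Q - \<epsilon> \<le> Q * ((1 / \<eta>) / (1 + 1 / \<eta>) powr (1 + \<eta>))\<^sup>2"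
proof -
  have "((\<lambda>\<eta>::real. (1 / \<eta>) / (1 + 1 / \<eta>) powr (1 + \<eta>)) \<longlongrightarrow> 1) (at_right 0)"
    by real_asymp
  then have "((\<lambda>\<eta>::real. Q * ((1 / \<eta>) / (1 + 1 / \<eta>) powr (1 + \<eta>))\<^sup>2) \<longlongrightarrow> Q * 1\<^sup>2) (at_right 0)"
    by (intro tendsto_intros)
  then have "eventually (\<lambda>\<eta>. Q - \<epsilon> < Q * ((1 / \<eta>) / (1 + 1 / \<eta>) powr (1 + \<eta>))\<^sup>2) (at_right 0)"
    by (rule order_tendstoD) (use assms in simp)
  moreover have "eventually (\<lambda>\<eta>::real. 0 < \<eta>) (at_right 0)" by (simp add: eventually_at_filter)
  ultimately have "eventually (\<lambda>\<eta>. Q - \<epsilon> < Q * ((1 / \<eta>) / (1 + 1 / \<eta>) powr (1 + \<eta>))\<^sup>2 \<and> 0 < \<eta>) (at_right 0)"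
    by eventually_elim simp
  then obtain \<eta> where "Q - \<epsilon> < Q * ((1 / \<eta>) / (1 + 1 / \<eta>) powr (1 + \<eta>))\<^sup>2 \<and> 0 < \<eta>"
    by (auto dest: eventually_happens'[OF trivial_limit_at_right_real])
  then show ?thesis by (intro that[of \<eta>]) auto
qed

theorem theorem5p2:
  fixes Q1 Q2 \<epsilon> :: real
  assumes "1 \<le> Q1" and "1 \<le> Q2" and "0 < \<epsilon>"
  shows "\<exists>(p::real) (u1 :: real \<Rightarrow> real) (u2 :: real \<Rightarrow> real) (x0::real).
           1 < p \<and> 0 \<le> x0 \<and> x0 < 1 \<and>
           quasiminimizer p Q1 {x0<..<1} u1 \<and>
           quasiminimizer p Q2 {0<..<1} u2 \<and>
           (\<exists>Q. optimal_quasisuperminimizer_constant p {0<..<1}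
                   (\<lambda>x. if x \<in> {x0<..<1} then min (u1 x) (u2 x) else u2 x) Q \<and>
                Q1 * Q2 - \<epsilon> \<le> Q)"
proof -
  obtain \<eta> where \<eta>: "0 < \<eta>" "Q1 * Q2 - \<epsilon> \<le> Q1 * Q2 * ((1 / \<eta>) / (1 + 1 / \<eta>) powr (1 + \<eta>))\<^sup>2"
    using exists_exponent_near_1[OF assms(3)] by blast
  define p where "p = 1 + \<eta>"
  define K where "K = 1 / \<eta>"
  define \<kappa> where "\<kappa> = K / (1 + K) powr p"
  define q1 where "q1 = Q1 powr (1 / \<eta>)"
  define q2 where "q2 = Q2 powr (1 / \<eta>)"
  define r1 where "r1 = K / (K + q1)"
  define r2 where "r2 = K / (K + q2)"
  have p: "1 < p" and K: "0 < K" using \<eta>(1) by (auto simp: p_def K_def)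
  have q: "1 \<le> q1" "1 \<le> q2" using assms \<eta>(1) by (auto simp: q1_def q2_def ge_one_powr_ge_zero)
  have qp: "q1 powr (p - 1) = Q1" "q2 powr (p - 1) = Q2"
    using assms \<eta>(1) by (auto simp: q1_def q2_def p_def powr_powr)
  have r: "0 < r1" "r1 < 1" "0 < r2" "r2 < 1" using K q by (auto simp: r1_def r2_def)
  \<comment> \<open>The slopes of \<open>u2\<close> are \<open>1\<close> on \<open>(0, x0)\<close> and \<open>q2\<close> on \<open>(x0, 1)\<close>, with average \<open>m\<close>.
    Those of \<open>u1\<close> on \<open>(x0, x1)\<close> and \<open>(x1, 1)\<close> are \<open>b\<close> and \<open>B\<close>, with average \<open>q2\<close>; the factor
    \<open>a1\<close> is that average for slopes \<open>1\<close> and \<open>q1\<close>.\<close>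
  define x0 where "x0 = 1 - r2"
  define x1 where "x1 = 1 - r1 * r2"
  define a1 where "a1 = 1 - r1 + r1 * q1"
  define m where "m = 1 - r2 + r2 * q2"
  define b where "b = q2 / a1"
  define B where "B = b * q1"
  have "r1 * r2 < 1 * r2" using r by (intro mult_strict_right_mono) auto
  then have x: "0 < x0" "x0 < x1" "x1 < 1" using r by (auto simp: x0_def x1_def)
  have a1_eq: "a1 = 1 + r1 * (q1 - 1)" "a1 = q1 - (1 - r1) * (q1 - 1)" by (auto simp: a1_def algebra_simps)
  have a1: "1 \<le> a1" "a1 \<le> q1" 
  proof -
    have "0 \<le> r1 * (q1 - 1)" "0 \<le> (1 - r1) * (q1 - 1)" using r q by simp_all
    then show "1 \<le> a1" "a1 \<le> q1" using a1_eq by linarith+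
  qed
  have b: "0 < b" "b \<le> q2" "q2 \<le> B"
    using a1 q by (auto simp: b_def B_def field_simps mult_left_mono)
  have m: "1 \<le> m" "m \<le> q2"
  proof -
    have "m = 1 + r2 * (q2 - 1)" "m = q2 - (1 - r2) * (q2 - 1)" by (auto simp: m_def algebra_simps)
    moreover have "0 \<le> r2 * (q2 - 1)" "0 \<le> (1 - r2) * (q2 - 1)" using r q by simp_all
    ultimately show "1 \<le> m" "m \<le> q2" by linarith+
  qed
  have kink2: "(m - 1) * (x0 - 0) = (q2 - m) * (1 - x0)" by (simp add: m_def x0_def algebra_simps)
  have kink1: "(q2 - b) * (x1 - x0) = (B - q2) * (1 - x1)"
  proof -
    have "q2 = b * a1" using a1 by (simp add: b_def)
    then have "q2 - b = b * (r1 * (q1 - 1))" "B - q2 = b * ((1 - r1) * (q1 - 1))"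
      by (simp_all add: B_def a1_def algebra_simps)
    moreover have "x1 - x0 = (1 - r1) * r2" "1 - x1 = r1 * r2" by (simp_all add: x0_def x1_def algebra_simps)
    ultimately show ?thesis by (simp only: mult_ac)
  qed
  \<comment> \<open>Both functions are written as the affine function \<open>m * x\<close> minus tents. Then \<open>u1\<close> and \<open>u2\<close>
    agree outside \<open>(x0, 1)\<close>, and \<open>T2 + T1\<close> is the competitor's test function.\<close>
  define T2 where "T2 = tent 0 x0 1 (m - 1) (q2 - m)"
  define T1 where "T1 = tent x0 x1 1 (q2 - b) (B - q2)"
  define t2 where "t2 = tent_slope 0 x0 1 (m - 1) (q2 - m)"
  define t1 where "t1 = tent_slope x0 x1 1 (q2 - b) (B - q2)"
  define u2 where "u2 x = m * x - T2 x" for x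
  define u1 where "u1 x = m * x - (T2 x + T1 x)" for x
  define S where "S = {0, x0, x1, 1}"
  have S: "finite S" by (simp add: S_def)
  have T2D: "(T2 has_real_derivative t2 x) (at x)" if "x \<notin> S" for x
    unfolding T2_def t2_def using that m x kink2 by (intro has_real_derivative_tent) (auto simp: S_def)
  have T1D: "(T1 has_real_derivative t1 x) (at x)" if "x \<notin> S" for x
    unfolding T1_def t1_def using that b x kink1 by (intro has_real_derivative_tent) (auto simp: S_def)
  have cont: "continuous_on UNIV T1" "continuous_on UNIV T2"
    unfolding T1_def T2_def by (intro continuous_on_tent)+
  have [measurable]: "t1 \<in> borel_measurable lebesgue" "t2 \<in> borel_measurable lebesgue"
    unfolding t1_def t2_def by measurable
  define C where "C = \<bar>m\<bar> + (\<bar>m - 1\<bar> + \<bar>q2 - m\<bar>) + (\<bar>q2 - b\<bar> + \<bar>B - q2\<bar>)"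
  have tb: "\<bar>t2 x\<bar> \<le> \<bar>m - 1\<bar> + \<bar>q2 - m\<bar>" "\<bar>t1 x\<bar> \<le> \<bar>q2 - b\<bar> + \<bar>B - q2\<bar>" for x
    unfolding t1_def t2_def by (rule tent_slope_bound)+
  have u2_cont: "continuous_on UNIV u2" unfolding u2_def[abs_def] by (intro continuous_intros cont)
  have u1_cont: "continuous_on UNIV u1" unfolding u1_def[abs_def] by (intro continuous_intros cont)
  have u2D: "has_weak_deriv {\<alpha><..<\<beta>} u2 (\<lambda>x. m - t2 x)" for \<alpha> \<beta>
  proof (rule has_weak_deriv_piecewise[OF S u2_cont, of _ C])
    show "(u2 has_real_derivative m - t2 x) (at x)" if "x \<notin> S" for x
      unfolding u2_def[abs_def] using T2D[OF that] by (auto intro!: derivative_eq_intros)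
    show "\<bar>m - t2 x\<bar> \<le> C" for x using tb[of x] unfolding C_def by linarith
  qed measurable
  have u1D: "has_weak_deriv {\<alpha><..<\<beta>} u1 (\<lambda>x. m - (t2 x + t1 x))" for \<alpha> \<beta>
  proof (rule has_weak_deriv_piecewise[OF S u1_cont, of _ C])
    show "(u1 has_real_derivative m - (t2 x + t1 x)) (at x)" if "x \<notin> S" for x
      unfolding u1_def[abs_def] using T2D[OF that] T1D[OF that] by (auto intro!: derivative_eq_intros)
    show "\<bar>m - (t2 x + t1 x)\<bar> \<le> C" for x using tb[of x] unfolding C_def by linarith
  qed measurable
  have u2_eq: "m - t2 x = (if x < x0 then 1 else if x = x0 then m else q2)" if "0 < x" "x < 1" for x
    using that x by (auto simp: t2_def tent_slope_def indicator_def)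
  have t1_eq: "t1 x = (if x \<le> x0 then 0 else if x < x1 then q2 - b else if x = x1 then 0 else q2 - B)"
    if "0 < x" "x < 1" for x
    using that x by (auto simp: t1_def tent_slope_def indicator_def)
  have u1_eq: "m - (t2 x + t1 x) =
      (if x < x0 then 1 else if x = x0 then m else if x < x1 then b else if x = x1 then q2 else B)"
    if "0 < x" "x < 1" for x
    using u2_eq[OF that] t1_eq[OF that] x by (auto split: if_splits)
  have qm2: "quasiminimizer p Q2 {0<..<1} u2"
  proof -
    have "quasiminimizer p ((q2 / 1) powr (p - 1)) {0<..<1} u2"
    proof (rule quasiminimizer_if_slopes_between[OF p _ u2D])
      show "in_Lp p {0<..<1} u2" using p by (intro in_Lp_continuous u2_cont) auto
      show "1 \<le> m - t2 x \<and> m - t2 x \<le> q2" if "0 < x" "x < 1" for x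
        using u2_eq[OF that] m q by auto
    qed (auto intro!: measurable_restrict_space1)
    then show ?thesis by (simp add: qp)
  qed
  have qm1: "quasiminimizer p Q1 {x0<..<1} u1"
  proof -
    have "quasiminimizer p ((B / b) powr (p - 1)) {x0<..<1} u1"
    proof (rule quasiminimizer_if_slopes_between[OF p _ u1D])
      show "in_Lp p {x0<..<1} u1" using p by (intro in_Lp_continuous u1_cont) auto
      show "b \<le> m - (t2 x + t1 x) \<and> m - (t2 x + t1 x) \<le> B" if "x0 < x" "x < 1" for x
        using u1_eq[of x] that x b by auto
    qed (use x b in \<open>auto intro!: measurable_restrict_space1\<close>)
    moreover have "B / b = q1" using b by (simp add: B_def)
    ultimately show ?thesis by (simp add: qp)
  qed
  \<comment> \<open>On all of \<open>(0, 1)\<close> the smallest slope of \<open>u1\<close> is \<open>1\<close> or \<open>b\<close>, so some finite constant is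
    admissible.\<close>
  define Q0 where "Q0 = (B / min 1 b) powr (p - 1)"
  have qm0: "quasiminimizer p Q0 {0<..<1} u1"
    unfolding Q0_def
  proof (rule quasiminimizer_if_slopes_between[OF p _ u1D])
    show "in_Lp p {0<..<1} u1" using p by (intro in_Lp_continuous u1_cont) auto
    show "min 1 b \<le> m - (t2 x + t1 x) \<and> m - (t2 x + t1 x) \<le> B" if "0 < x" "x < 1" for x
      using u1_eq[OF that] b m q by auto
  qed (use b in \<open>auto intro!: measurable_restrict_space1\<close>)
  have "min 1 b \<le> B" using b by auto
  then have Q0: "1 \<le> Q0" unfolding Q0_def using b p by (intro ge_one_powr_ge_zero) (auto simp: field_simps)
  have T_nonneg: "0 \<le> T1 x" "0 \<le> T2 x" for x by (auto simp: T1_def T2_def tent_nonneg)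
  have T1_0: "T1 x = 0" if "x \<notin> {x0<..<1}" for x
    unfolding T1_def using that b x by (intro tent_outside) auto
  have u_eq: "(\<lambda>x. if x \<in> {x0<..<1} then min (u1 x) (u2 x) else u2 x) = u1"
    using T_nonneg(1) T1_0 by (auto simp: fun_eq_iff u1_def u2_def)
  define \<phi> where "\<phi> x = T2 x + T1 x" for x
  have \<phi>_cont: "continuous_on UNIV \<phi>" unfolding \<phi>_def[abs_def] by (intro continuous_intros cont)
  have \<phi>W: "\<phi> \<in> W1p_0 p {0<..<1}"
  proof (rule W1p_0_if_piecewise_derivative_limit[OF p _ S \<phi>_cont])
    let ?g2 = "\<lambda>n x. (m - 1) * bump 0 x0 (Suc n) x + (- (q2 - m)) * bump x0 1 (Suc n) x"
    let ?g1 = "\<lambda>n x. (q2 - b) * bump x0 x1 (Suc n) x + (- (B - q2)) * bump x1 1 (Suc n) x"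
    show "(\<phi> has_real_derivative t2 x + t1 x) (at x)" if "x \<notin> S" for x
      unfolding \<phi>_def[abs_def] by (intro DERIV_add T2D T1D that)
    show "\<phi> 0 = 0" "\<phi> 1 = 0" unfolding \<phi>_def T1_def T2_def using m b x by (auto simp: tent_outside)
    show "test_function {0<..<1} (\<lambda>x. ?g2 n x + ?g1 n x)" for n
      using x by (intro test_function_add test_function_mult_left test_function_bump smooth_const) auto
    show "\<bar>?g2 n x + ?g1 n x\<bar> \<le> C" for n x
      using tent_slope_approx_bound[of "m - 1" 0 x0 "Suc n" x "q2 - m" 1]
        tent_slope_approx_bound[of "q2 - b" x0 x1 "Suc n" x "B - q2" 1]
      unfolding C_def by linarith
    show "(\<lambda>n. ?g2 n x + ?g1 n x) \<longlonglongrightarrow> t2 x + t1 x" for x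
      unfolding t1_def t2_def by (intro tendsto_add tent_slope_approx)
  qed simp
  have lower: "Q1 * Q2 - \<epsilon> \<le> Q" if Q: "1 \<le> Q" "quasisuperminimizer p Q {0<..<1} u1" for Q
  proof -
    have parts: "\<kappa> * Q1 * a1 powr p \<le> r1 * q1 powr p" "\<kappa> * Q2 * m powr p \<le> r2 * q2 powr p"
      using energy_of_steep_part[OF K, of p q1] energy_of_steep_part[OF K, of p q2] p q
      unfolding \<kappa>_def a1_def m_def r1_def r2_def by (auto simp: qp)
    have "(\<kappa> * Q1 * a1 powr p) * (\<kappa> * Q2 * m powr p) \<le> (r1 * q1 powr p) * (r2 * q2 powr p)"
      by (rule mult_mono[OF parts]) (use K assms r in \<open>simp_all add: \<kappa>_def\<close>)
    also have "\<dots> = r1 * r2 * (q1 powr p * q2 powr p)" by simp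
    also have "q1 powr p * q2 powr p = B powr p * a1 powr p"
      using a1 q by (simp add: B_def b_def powr_mult powr_divide)
    finally have "(Q1 * Q2 * \<kappa>\<^sup>2 * m powr p) * a1 powr p \<le> (r1 * r2 * B powr p) * a1 powr p"
      by (simp add: power2_eq_square mult_ac)
    moreover have "0 < a1 powr p" using a1 by simp
    ultimately have energies: "Q1 * Q2 * \<kappa>\<^sup>2 * m powr p \<le> r1 * r2 * B powr p"
      by (rule mult_right_le_imp_le)
    have "Q1 * Q2 * \<kappa>\<^sup>2 \<le> Q"
      \<comment> \<open>If \<open>B = m\<close> then \<open>u1\<close> is affine and \<open>\<phi>\<close> vanishes, so \<open>\<phi>\<close> gives no information; the
        required bound is then at most \<open>1\<close>.\<close>
    proof (cases "B = m")
      case True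
      then have "Q1 * Q2 * \<kappa>\<^sup>2 \<le> r1 * r2" using energies m by simp
      also have "\<dots> \<le> 1" using r by (intro mult_le_one) auto
      finally show ?thesis using Q(1) by linarith
    next
      case False
      then have "m < B" using m b by linarith
      let ?M = "lebesgue_on {0<..<1::real}" and ?G = "indicator {x. \<phi> x \<noteq> 0} :: real \<Rightarrow> real"
      interpret M: finite_measure ?M by (rule finite_measure_lebesgue_on_Ioo)
      have \<phi>m: "\<phi> \<in> borel_measurable ?M"
        by (intro continuous_imp_measurable_on_sets_lebesgue continuous_on_subset[OF \<phi>_cont]) auto
      have mD: "has_weak_deriv {0<..<1} (\<lambda>x. u1 x + \<phi> x) (\<lambda>x. m)"
      proof -
        have "(\<lambda>x. u1 x + \<phi> x) = (\<lambda>x. m * x)" by (simp add: u1_def \<phi>_def)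
        moreover have "has_weak_deriv {0<..<1} (\<lambda>x. m * x) (\<lambda>x. m)"
          by (rule has_weak_deriv_piecewise[of "{}" _ _ "\<bar>m\<bar>"]) (auto intro!: derivative_eq_intros continuous_intros)
        ultimately show ?thesis by simp
      qed
      have g1L: "in_Lp p {0<..<1} (\<lambda>x. m - (t2 x + t1 x))"
      proof (rule in_Lp_bounded)
        show "\<bar>m - (t2 x + t1 x)\<bar> \<le> C" for x using tb[of x] unfolding C_def by linarith
      qed (use p in \<open>auto intro!: measurable_restrict_space1\<close>)
      have mL: "in_Lp p {0<..<1} (\<lambda>x. m)" using p by (intro in_Lp_continuous) auto
      note E = energy_eq_integral[OF u1D g1L \<phi>m] and E' = energy_eq_integral[OF mD mL \<phi>m]
      have "energy p {0<..<1} \<phi> u1 \<le> ennreal Q * energy p {0<..<1} \<phi> (\<lambda>x. u1 x + \<phi> x)"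
        using Q(2) \<phi>W T_nonneg by (auto simp: quasisuperminimizer_def \<phi>_def)
      then have le: "(\<integral>x. ?G x * \<bar>m - (t2 x + t1 x)\<bar> powr p \<partial>?M) \<le> Q * (\<integral>x. ?G x * \<bar>m\<bar> powr p \<partial>?M)"
        unfolding E(1) E'(1) using Q(1) by (simp flip: ennreal_mult' add: ennreal_le_iff)
      have "(\<integral>x. ?G x * \<bar>m\<bar> powr p \<partial>?M) \<le> (\<integral>x. m powr p \<partial>?M)"
        using E'(2) m by (intro integral_mono) (auto simp: indicator_def)
      also have "\<dots> = m powr p" by (simp add: measure_restrict_space space_restrict_space)
      finally have upper: "(\<integral>x. ?G x * \<bar>m\<bar> powr p \<partial>?M) \<le> m powr p" .
      \<comment> \<open>The energy of \<open>u1\<close> is bounded below by that of the last piece, where \<open>\<phi>\<close> is positive.\<close>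
      have "r1 * r2 * B powr p = (\<integral>x. indicator {x1<..<1} x * B powr p \<partial>?M)"
      proof -
        have "(\<integral>x. indicator {x1<..<1} x * B powr p \<partial>?M) =
            (\<integral>x. indicator {0<..<1} x *\<^sub>R (indicator {x1<..<1} x * B powr p) \<partial>lebesgue)"
          by (rule integral_restrict_space) simp
        also have "(\<lambda>x. indicator {0<..<1} x *\<^sub>R (indicator {x1<..<1} x * B powr p)) =
            (\<lambda>x. indicator {x1<..<1} x * B powr p)" using x by (auto simp: fun_eq_iff indicator_def)
        also have "(\<integral>x. indicator {x1<..<1} x * B powr p \<partial>lebesgue) = r1 * r2 * B powr p"
          using x by (simp add: x1_def)
        finally show ?thesis by (rule sym)
      qed
      also have "\<dots> \<le> (\<integral>x. ?G x * \<bar>m - (t2 x + t1 x)\<bar> powr p \<partial>?M)"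
      proof (rule integral_mono)
        have "{x1<..<1} \<in> sets ?M" using x by (auto simp: sets_restrict_space_iff)
        then show "integrable ?M (\<lambda>x. indicator {x1<..<1} x * B powr p)"
          by (intro integrable_mult_left integrable_real_indicator) (simp_all add: less_top[symmetric] M.emeasure_finite)
        show "integrable ?M (\<lambda>x. ?G x * \<bar>m - (t2 x + t1 x)\<bar> powr p)" by (rule E(2))
        fix y
        show "indicator {x1<..<1} y * B powr p \<le> ?G y * \<bar>m - (t2 y + t1 y)\<bar> powr p"
        proof (cases "y \<in> {x1<..<1}")
          case True
          then have y: "x1 < y" "y < 1" "x0 < y" "0 < y" using x by auto
          have "T2 y = (q2 - m) * (1 - y)"
            unfolding T2_def using y m x kink2 by (intro tent_right) auto
          moreover have "T1 y = (B - q2) * (1 - y)"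
            unfolding T1_def using y b x kink1 by (intro tent_right) auto
          ultimately have "\<phi> y = (B - m) * (1 - y)" by (simp add: \<phi>_def algebra_simps)
          then have "\<phi> y \<noteq> 0" using \<open>m < B\<close> y by simp
          then show ?thesis using u1_eq[of y] y b by simp
        qed simp
      qed
      also have "\<dots> \<le> Q * m powr p" using le upper Q(1) mult_left_mono[OF upper, of Q] by linarith
      finally have "Q1 * Q2 * \<kappa>\<^sup>2 * m powr p \<le> Q * m powr p" using energies by linarith
      then show ?thesis using m by simp
    qed
    then show ?thesis using \<eta>(2) by (simp add: \<kappa>_def K_def p_def)
  qed
  have "\<exists>Q. optimal_quasisuperminimizer_constant p {0<..<1}
            (\<lambda>x. if x \<in> {x0<..<1} then min (u1 x) (u2 x) else u2 x) Q \<and> Q1 * Q2 - \<epsilon> \<le> Q"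
    unfolding u_eq
    by (rule optimal_quasisuperminimizer_constant_exists[OF quasisuperminimizer_if_quasiminimizer[OF qm0] Q0 lower])
  moreover have "0 \<le> x0" "x0 < 1" using x by auto
  ultimately show ?thesis using p qm1 qm2 by blast
qed

end
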